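(* Let $R$ be a left Artinian ring and $e=\sum_{e'\in\min\mathcal{I}'_l(R)}e'$. Then 1. $T_l(R)=\bigcap_{S\in\mathrm{max.Den}_l(R)}S=\{u\in R\mid u+(1-e')R\in(R/(1-e')R)^*\text{ for all }e'\in\min\mathcal{I}'_l(R)\}$. 2. $\mathfrak{l}^s_R=\mathfrak{l}_R=(1-e)R$. 3. $Q_l^s(R)=R/\mathfrak{l}^s_R\simeq R/(1-e)R\simeq\prod_{e'\in\min\mathcal{I}'_l(R)}R/(1-e')R\simeq\prod_{S\in\mathrm{max.Den}_l(R)}S^{-1}R$.
   Context: Rings are associative with $1$ and nonzero; $A^*$ is the group of units of a ring $A$. A multiplicative subset $S$ of $R$ is a submonoid of $(R,\cdot)$ with $1\in S$, $0\notin S$. It is a left Ore set if $Sr\cap Rs\neq\emptyset$ for all $r\in R$, $s\in S$; then $\mathrm{ass}(S):=\{r\in R\mid sr=0 \text{ for some } s\in S\}$ is an ideal. A left Ore set $S$ is a left denominator set if $rs=0$ with $r\in R$, $s\in S$ implies $r\in\mathrm{ass}(S)$. $\mathrm{Den}_l(R)$ is the set of left denominator sets of $R$; for $S\in\mathrm{Den}_l(R)$, $S^{-1}R=\{s^{-1}r\mid s\in S,r\in R\}$ is the left localization. $\mathrm{max.Den}_l(R)$ is the (non-empty) set of elements of $\mathrm{Den}_l(R)$ maximal under inclusion. $\mathcal{L}^s_l(R):=\bigcap_{S\in \mathrm{max.Den}_l(R)}S$ and $\mathfrak{l}_R:=\bigcap_{S\in\mathrm{max.Den}_l(R)}\mathrm{ass}(S)$.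 $T_l(R)$ is the union of all $S\in\mathrm{Den}_l(R)$ with $S\subseteq\mathcal{L}^s_l(R)$; it is the largest left denominator set of $R$ contained in $\mathcal{L}^s_l(R)$. $Q_l^s(R):=T_l(R)^{-1}R$ and $\mathfrak{l}^s_R:=\mathrm{ass}(T_l(R))$. For a left Artinian ring $R$ with (Jacobson) radical $\mathrm{rad}(R)$, write $\overline{R}:=R/\mathrm{rad}(R)=\prod_{i=1}^s\overline{R}_i$, a product of simple Artinian rings, let $\overline{1}_i$ be the identity element of $\overline{R}_i$, and fix a decomposition $1=\sum_{i=1}^s1_i$ into orthogonal idempotents of $R$ such that $1_i$ lifts $\overline{1}_i$. For a non-empty subset $I\subseteq\{1,\ldots,s\}$ put $e_I:=\sum_{i\in I}1_i$, and let $\mathcal{I}'_l(R):=\{e_I\mid e_IR(1-e_I)=0\}$, partially ordered by $e_I\leq e_J$ iff $I\subseteq J$. $\min\mathcal{I}'_l(R)$ is its set of minimal elements. (For $e'\in\mathcal{I}'_l(R)$, $(1-e')R$ is a two-sided ideal.) The equality $Q_l^s(R)=R/\mathfrak{l}^s_R$ means that the canonical map $R/\mathfrak{l}^s_R\to Q_l^s(R)$ is an isomorphism. *)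

theory Defs
  imports "HOL-Algebra.Algebra"
begin

section \<open>Left Artinian rings and the radical\<close>

text \<open>The locale \<^locale>\<open>ring\<close> does not assume commutativity. The library only has two-sided ideals.\<close>

definition left_ideal :: "('a, 'm) ring_scheme \<Rightarrow> 'a set \<Rightarrow> bool" where
  "left_ideal R I \<longleftrightarrow>
     additive_subgroup I R \<and> (\<forall>r\<in>carrier R. \<forall>x\<in>I. r \<otimes>\<^bsub>R\<^esub> x \<in> I)"

definition maximal_left_ideal :: "('a, 'm) ring_scheme \<Rightarrow> 'a set \<Rightarrow> bool" where
  "maximal_left_ideal R M \<longleftrightarrow>
     left_ideal R M \<and> M \<noteq> carrier R \<and>
     (\<forall>I. left_ideal R I \<longrightarrow> M \<subseteq> I \<longrightarrow> I = M \<or> I = carrier R)"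

definition jacobson_radical :: "('a, 'm) ring_scheme \<Rightarrow> 'a set" where
  "jacobson_radical R = {r \<in> carrier R. \<forall>M. maximal_left_ideal R M \<longrightarrow> r \<in> M}"

locale left_artinian_ring = ring +
  assumes one_not_zero: "\<one> \<noteq> \<zero>"
    and descending_chain:
      "(\<And>n::nat. left_ideal R (I n)) \<Longrightarrow> (\<And>n. I (Suc n) \<subseteq> I n) \<Longrightarrow> \<exists>n. \<forall>m\<ge>n. I m = I n"

text \<open>For simple rings the left and the right Artinian conditions are equivalent.\<close>

locale simple_artinian_ring = left_artinian_ring +
  assumes simple: "ideal I R \<Longrightarrow> I = {\<zero>} \<or> I = carrier R"

definition product_ring :: "'i set \<Rightarrow> ('i \<Rightarrow> ('a, 'm) ring_scheme) \<Rightarrow> ('i \<Rightarrow> 'a) ring" where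
  "product_ring I G =
     \<lparr>carrier = (\<Pi>\<^sub>E i\<in>I. carrier (G i)),
      monoid.mult = (\<lambda>x y. \<lambda>i\<in>I. x i \<otimes>\<^bsub>G i\<^esub> y i),
      one = (\<lambda>i\<in>I. \<one>\<^bsub>G i\<^esub>),
      ring.zero = (\<lambda>i\<in>I. \<zero>\<^bsub>G i\<^esub>),
      add = (\<lambda>x y. \<lambda>i\<in>I. x i \<oplus>\<^bsub>G i\<^esub> y i)\<rparr>"

definition right_principal :: "('a, 'm) ring_scheme \<Rightarrow> 'a \<Rightarrow> 'a set" where
  "right_principal R a = a <#\<^bsub>R\<^esub> carrier R"


section \<open>Left denominator sets and left localizations\<close>

definition multiplicative_subset :: "('a, 'm) ring_scheme \<Rightarrow> 'a set \<Rightarrow> bool" where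
  "multiplicative_subset R S \<longleftrightarrow> submonoid S R \<and> \<zero>\<^bsub>R\<^esub> \<notin> S"

definition left_Ore_set :: "('a, 'm) ring_scheme \<Rightarrow> 'a set \<Rightarrow> bool" where
  "left_Ore_set R S \<longleftrightarrow>
     multiplicative_subset R S \<and>
     (\<forall>r\<in>carrier R. \<forall>s\<in>S. {t \<otimes>\<^bsub>R\<^esub> r | t. t \<in> S} \<inter> {a \<otimes>\<^bsub>R\<^esub> s | a. a \<in> carrier R} \<noteq> {})"

definition ass :: "('a, 'm) ring_scheme \<Rightarrow> 'a set \<Rightarrow> 'a set" where
  "ass R S = {r \<in> carrier R. \<exists>s\<in>S. s \<otimes>\<^bsub>R\<^esub> r = \<zero>\<^bsub>R\<^esub>}"

definition Den_l :: "('a, 'm) ring_scheme \<Rightarrow> 'a set set" where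
  "Den_l R =
     {S. left_Ore_set R S \<and> (\<forall>r\<in>carrier R. \<forall>s\<in>S. r \<otimes>\<^bsub>R\<^esub> s = \<zero>\<^bsub>R\<^esub> \<longrightarrow> r \<in> ass R S)}"

definition max_Den_l :: "('a, 'm) ring_scheme \<Rightarrow> 'a set set" where
  "max_Den_l R = {S \<in> Den_l R. \<forall>S'\<in>Den_l R. S \<subseteq> S' \<longrightarrow> S' = S}"

text \<open>
  In the following construction the pair \<open>(s, r)\<close> stands for the left fraction
  \<open>s\<inverse> r\<close>. Two fractions are equal iff they can be expanded from the left to the same
  numerator and the same denominator in \<open>S\<close>.
\<close>

definition fraction_rel :: "('a, 'm) ring_scheme \<Rightarrow> 'a set \<Rightarrow> (('a \<times> 'a) \<times> ('a \<times> 'a)) set" where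
  "fraction_rel R S =
     {((s, r), (s', r')). s \<in> S \<and> r \<in> carrier R \<and> s' \<in> S \<and> r' \<in> carrier R \<and>
        (\<exists>c\<in>carrier R. \<exists>d\<in>carrier R.
           c \<otimes>\<^bsub>R\<^esub> s \<in> S \<and> c \<otimes>\<^bsub>R\<^esub> s = d \<otimes>\<^bsub>R\<^esub> s' \<and> c \<otimes>\<^bsub>R\<^esub> r = d \<otimes>\<^bsub>R\<^esub> r')}"

definition fraction :: "('a, 'm) ring_scheme \<Rightarrow> 'a set \<Rightarrow> 'a \<Rightarrow> 'a \<Rightarrow> ('a \<times> 'a) set" where
  "fraction R S s r = fraction_rel R S `` {(s, r)}"

text \<open>
  Multiplication: if \<open>t' r = a t\<close> with \<open>t' \<in> S\<close>, then \<open>r t\<inverse> = t'\<inverse> a\<close> and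
  \<open>(s\<inverse> r) (t\<inverse> q) = (t' s)\<inverse> (a q)\<close>.
  Addition: if \<open>a s = b t \<in> S\<close>, then \<open>s\<inverse> r + t\<inverse> q = (a s)\<inverse> (a r + b q)\<close>.
  Both unions range over all representatives and all admissible choices; when \<open>S\<close> is a
  left denominator set, all the classes united coincide.
\<close>

definition left_localization :: "('a, 'm) ring_scheme \<Rightarrow> 'a set \<Rightarrow> (('a \<times> 'a) set) ring" where
  "left_localization R S =
     \<lparr>carrier = (S \<times> carrier R) // fraction_rel R S,
      monoid.mult = (\<lambda>x y. \<Union>(s, r)\<in>x. \<Union>(t, q)\<in>y.
        \<Union>{fraction R S (t' \<otimes>\<^bsub>R\<^esub> s) (a \<otimes>\<^bsub>R\<^esub> q) | t' a.
            t' \<in> S \<and> a \<in> carrier R \<and> t' \<otimes>\<^bsub>R\<^esub> r = a \<otimes>\<^bsub>R\<^esub> t}),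
      one = fraction R S \<one>\<^bsub>R\<^esub> \<one>\<^bsub>R\<^esub>,
      ring.zero = fraction R S \<one>\<^bsub>R\<^esub> \<zero>\<^bsub>R\<^esub>,
      add = (\<lambda>x y. \<Union>(s, r)\<in>x. \<Union>(t, q)\<in>y.
        \<Union>{fraction R S (a \<otimes>\<^bsub>R\<^esub> s) (a \<otimes>\<^bsub>R\<^esub> r \<oplus>\<^bsub>R\<^esub> b \<otimes>\<^bsub>R\<^esub> q) | a b.
            a \<in> carrier R \<and> b \<in> carrier R \<and> a \<otimes>\<^bsub>R\<^esub> s \<in> S \<and> a \<otimes>\<^bsub>R\<^esub> s = b \<otimes>\<^bsub>R\<^esub> t})\<rparr>"

definition localization_map :: "('a, 'm) ring_scheme \<Rightarrow> 'a set \<Rightarrow> 'a \<Rightarrow> ('a \<times> 'a) set" where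
  "localization_map R S r = fraction R S \<one>\<^bsub>R\<^esub> r"

text \<open>
  The map \<open>R/ass(S) \<rightarrow> S\<inverse>R\<close>, \<open>r + ass(S) \<mapsto> 1\<inverse> r\<close>, written in the same way as the
  induced map in the library's homomorphism theorem \<open>FactRing_iso_set\<close>.
\<close>

definition canonical_map :: "('a, 'm) ring_scheme \<Rightarrow> 'a set \<Rightarrow> 'a set \<Rightarrow> ('a \<times> 'a) set" where
  "canonical_map R S C = the_elem (localization_map R S ` C)"


section \<open>Intersections of the maximal left denominator sets\<close>

text \<open>The intersections are over a non-empty set: by Zorn's lemma every nonzero ring has a maximal
  left denominator set. The ideals \<open>ass_max R\<close> and \<open>ass_T_l R\<close> are usually written \<open>l\<^sub>R\<close>
  and \<open>l\<^sup>s\<^sub>R\<close>.\<close>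

definition L_l_s :: "('a, 'm) ring_scheme \<Rightarrow> 'a set" where
  "L_l_s R = \<Inter> (max_Den_l R)"

definition ass_max :: "('a, 'm) ring_scheme \<Rightarrow> 'a set" where
  "ass_max R = (\<Inter>S\<in>max_Den_l R. ass R S)"

definition T_l :: "('a, 'm) ring_scheme \<Rightarrow> 'a set" where
  "T_l R = \<Union> {S \<in> Den_l R. S \<subseteq> L_l_s R}"

definition Q_l_s :: "('a, 'm) ring_scheme \<Rightarrow> (('a \<times> 'a) set) ring" where
  "Q_l_s R = left_localization R (T_l R)"

definition ass_T_l :: "('a, 'm) ring_scheme \<Rightarrow> 'a set" where
  "ass_T_l R = ass R (T_l R)"


section \<open>Idempotents of a left Artinian ring\<close>

text \<open>
  \<open>h\<close> identifies \<open>R/rad(R)\<close> with a direct product of simple Artinian rings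
  \<open>Rbar 1, ..., Rbar s\<close>, and \<open>\<epsilon> i\<close> is a lift to \<open>R\<close> of the identity element
  of the \<open>i\<close>-th factor, i.e. of the tuple with entry 1 in place \<open>i\<close> and 0 elsewhere.
\<close>

definition semisimple_quotient_decomposition ::
  "('a, 'm) ring_scheme \<Rightarrow> nat \<Rightarrow> (nat \<Rightarrow> ('b, 'n) ring_scheme) \<Rightarrow> ('a set \<Rightarrow> nat \<Rightarrow> 'b) \<Rightarrow> bool" where
  "semisimple_quotient_decomposition R s Rbar h \<longleftrightarrow>
     (\<forall>i\<in>{1..s}. simple_artinian_ring (Rbar i)) \<and>
     h \<in> ring_iso (R Quot jacobson_radical R) (product_ring {1..s} Rbar)"

definition lifted_idempotents ::
  "('a, 'm) ring_scheme \<Rightarrow> nat \<Rightarrow> (nat \<Rightarrow> ('b, 'n) ring_scheme) \<Rightarrow> ('a set \<Rightarrow> nat \<Rightarrow> 'b) \<Rightarrow>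
     (nat \<Rightarrow> 'a) \<Rightarrow> bool" where
  "lifted_idempotents R s Rbar h \<epsilon> \<longleftrightarrow>
     (\<forall>i\<in>{1..s}. \<epsilon> i \<in> carrier R) \<and>
     (\<forall>i\<in>{1..s}. \<forall>j\<in>{1..s}. \<epsilon> i \<otimes>\<^bsub>R\<^esub> \<epsilon> j = (if i = j then \<epsilon> i else \<zero>\<^bsub>R\<^esub>)) \<and>
     (\<Oplus>\<^bsub>R\<^esub>i\<in>{1..s}. \<epsilon> i) = \<one>\<^bsub>R\<^esub> \<and>
     (\<forall>i\<in>{1..s}. h (jacobson_radical R +>\<^bsub>R\<^esub> \<epsilon> i) =
        (\<lambda>j\<in>{1..s}. if j = i then \<one>\<^bsub>Rbar j\<^esub> else \<zero>\<^bsub>Rbar j\<^esub>))"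

definition idem_sum :: "('a, 'm) ring_scheme \<Rightarrow> (nat \<Rightarrow> 'a) \<Rightarrow> nat set \<Rightarrow> 'a" where
  "idem_sum R \<epsilon> I = (\<Oplus>\<^bsub>R\<^esub>i\<in>I. \<epsilon> i)"

definition I'_l :: "('a, 'm) ring_scheme \<Rightarrow> nat \<Rightarrow> (nat \<Rightarrow> 'a) \<Rightarrow> 'a set" where
  "I'_l R s \<epsilon> =
     {idem_sum R \<epsilon> I | I. I \<subseteq> {1..s} \<and> I \<noteq> {} \<and>
        (\<forall>r\<in>carrier R. idem_sum R \<epsilon> I \<otimes>\<^bsub>R\<^esub> r \<otimes>\<^bsub>R\<^esub> (\<one>\<^bsub>R\<^esub> \<ominus>\<^bsub>R\<^esub> idem_sum R \<epsilon> I) = \<zero>\<^bsub>R\<^esub>)}"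

definition idem_le :: "('a, 'm) ring_scheme \<Rightarrow> nat \<Rightarrow> (nat \<Rightarrow> 'a) \<Rightarrow> 'a \<Rightarrow> 'a \<Rightarrow> bool" where
  "idem_le R s \<epsilon> e f \<longleftrightarrow>
     (\<exists>I J. I \<noteq> {} \<and> I \<subseteq> J \<and> J \<subseteq> {1..s} \<and> e = idem_sum R \<epsilon> I \<and> f = idem_sum R \<epsilon> J)"

definition min_I'_l :: "('a, 'm) ring_scheme \<Rightarrow> nat \<Rightarrow> (nat \<Rightarrow> 'a) \<Rightarrow> 'a set" where
  "min_I'_l R s \<epsilon> = {e \<in> I'_l R s \<epsilon>. \<forall>f\<in>I'_l R s \<epsilon>. idem_le R s \<epsilon> f e \<longrightarrow> f = e}"

end

theory Submission
  imports Defs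
begin

text \<open>
  Let \<open>S\<close> be a left denominator set and choose \<open>s \<in> S\<close> with \<open>R s\<close> minimal. The Ore condition
  gives \<open>s ass(S) = 0\<close>, and \<open>R s\<^sup>2 = R s\<close> produces an idempotent \<open>f = c s\<close> with
  \<open>f R (1 - f) = 0\<close> and \<open>ass(S) = (1 - f)R\<close>, modulo which all elements of \<open>S\<close> are units.
  Modulo the radical, \<open>f\<close> is central, so it is conjugate to some \<open>e\<^sub>I \<in> I'\<^sub>l(R)\<close> and
  \<open>(1 - f)R = (1 - e\<^sub>I)R\<close>. Conversely, for each \<open>e'\<close> in \<open>I'\<^sub>l(R)\<close> the preimage of the units of
  \<open>R/(1 - e')R\<close> is a left denominator set with localization \<open>R/(1 - e')R\<close>, because \<open>e'\<close> lies in
  it and kills \<open>(1 - e')R\<close>. Hence these preimages for minimal \<open>e'\<close> are the maximal left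
  denominator sets. The minimal \<open>e'\<close> are orthogonal, so \<open>R/(1 - e)R\<close> is the product of the
  \<open>R/(1 - e')R\<close>, and the intersection of the preimages is the preimage of the units of the product.
\<close>

section \<open>Localization at the preimage of the units of a quotient\<close>

text \<open>No universal property of localization is used. Everything rests on one situation: a
  surjective ring homomorphism \<open>h\<close> whose kernel is killed from the left by a single
  element \<open>w\<close> with \<open>h w\<close> invertible. Equations that hold after
  \<open>h\<close> become equations in \<open>R\<close> after multiplication by \<open>w\<close>,
  and a fraction amounts to an element of the target of \<open>h\<close>. The situation occurs for
  each \<open>R/(1 - e')R\<close> and again for their product; the second case makes the
  intersection of the maximal sets a left denominator set itself and computes its localization at
  the same time.

  The idempotent \<open>f\<close> obtained from a denominator set is not unique and need not be one
  of the \<open>e_I\<close>. Only its right annihilator \<open>(1 - f)R\<close> is determined, so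
  idempotents are compared through the equations \<open>f r = 0\<close>. The condition
  \<open>f R (1 - f) = 0\<close> is used in the form \<open>f x f = f x\<close>, which allows a
  factor \<open>f\<close> to be inserted after any \<open>x\<close> that follows an
  \<open>f\<close>.\<close>

lemma UN_UN_Union_eq:
  assumes "\<And>z z' V. \<lbrakk>z \<in> A; z' \<in> B; V \<in> F z z'\<rbrakk> \<Longrightarrow> V = C" "z \<in> A" "z' \<in> B" "V \<in> F z z'"
  shows "(\<Union>z\<in>A. \<Union>z'\<in>B. \<Union> (F z z')) = C"
  using assms by blast

text \<open>The homomorphisms in view are the maps onto \<open>R/(1 - e)R\<close> and onto a product
  of such quotients; \<open>w\<close> is then the idempotent, respectively the sum of the
  idempotents, and \<open>h w\<close> is even the identity. Such a \<open>w\<close> is one common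
  denominator that annihilates every element of the kernel.\<close>

locale unit_preimage = ring_hom_ring +
  fixes w
  assumes surj: "h ` carrier R = carrier S"
    and nontrivial: "\<one>\<^bsub>S\<^esub> \<noteq> \<zero>\<^bsub>S\<^esub>"
    and w_closed: "w \<in> carrier R"
    and w_unit: "h w \<in> Units S"
    and annihilates_kernel: "\<lbrakk>x \<in> carrier R; h x = \<zero>\<^bsub>S\<^esub>\<rbrakk> \<Longrightarrow> w \<otimes> x = \<zero>"
begin

definition denominators where
  "denominators = {r \<in> carrier R. h r \<in> Units S}"

text \<open>All pairs representing \<open>x = h(s)^{-1} h(r)\<close>, with the inverse cleared.
  These sets turn out to be exactly the elements of the localization, so sending \<open>x\<close> to
  its class is the isomorphism sought.\<close>

definition fraction_class where
  "fraction_class x = {(s, r). s \<in> denominators \<and> r \<in> carrier R \<and> h s \<otimes>\<^bsub>S\<^esub> x = h r}"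

lemma kernel_iff: "r \<in> a_kernel R S h \<longleftrightarrow> r \<in> carrier R \<and> h r = \<zero>\<^bsub>S\<^esub>"
  unfolding a_kernel_def' by blast

lemma denominatorsI: "\<lbrakk>s \<in> carrier R; h s \<in> Units S\<rbrakk> \<Longrightarrow> s \<in> denominators"
  by (simp add: denominators_def)

lemma denominatorsD [simp]:
  assumes "s \<in> denominators"
  shows "s \<in> carrier R" "h s \<in> Units S"
  using assms by (auto simp: denominators_def)

lemma one_denominators [simp]: "\<one> \<in> denominators"
  by (rule denominatorsI) auto

lemma mult_denominators: "\<lbrakk>s \<in> denominators; t \<in> denominators\<rbrakk> \<Longrightarrow> s \<otimes> t \<in> denominators"
  by (rule denominatorsI) auto

text \<open>Equality of fractions asks only that \<open>c \<otimes> s\<close> lie in the set, for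
  arbitrary expanding factors in \<open>R\<close>. These factors are denominators automatically,
  because \<open>h a = h(as) h(s)^{-1}\<close> is a product of units.\<close>

lemma left_factor_denominators:
  assumes "a \<in> carrier R" "s \<in> denominators" "a \<otimes> s \<in> denominators"
  shows "a \<in> denominators"
proof -
  have u: "h s \<in> Units S" "h a \<otimes>\<^bsub>S\<^esub> h s \<in> Units S"
    using assms by (metis denominatorsD hom_mult)+
  then have "h a = (h a \<otimes>\<^bsub>S\<^esub> h s) \<otimes>\<^bsub>S\<^esub> inv\<^bsub>S\<^esub> (h s)"
    using assms by (simp add: S.m_assoc)
  then have "h a \<in> Units S"
    using u by (metis S.Units_inv_Units S.Units_m_closed)
  then show ?thesis
    using assms by (intro denominatorsI)
qed

text \<open>The difference \<open>x - y\<close> lies in the kernel of \<open>h\<close>, which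
  \<open>w\<close> kills. This is how equations in \<open>S\<close> are brought back to
  \<open>R\<close>.\<close>

lemma w_cancel:
  assumes "x \<in> carrier R" "y \<in> carrier R" "h x = h y"
  shows "w \<otimes> x = w \<otimes> y"
proof -
  have "h (x \<ominus> y) = \<zero>\<^bsub>S\<^esub>"
    using assms by (simp add: R.minus_eq S.r_neg)
  then have "w \<otimes> (x \<ominus> y) = \<zero>"
    using annihilates_kernel assms by simp
  then have "w \<otimes> x \<ominus> w \<otimes> y = \<zero>"
    using assms w_closed by (simp add: R.minus_eq R.r_distr R.r_minus)
  then show ?thesis
    using assms w_closed by simp
qed

lemma preimage_of:
  assumes "y \<in> carrier S" obtains a where "a \<in> carrier R" "h a = y"
  using assms surj by (metis imageE)

text \<open>A preimage \<open>a\<close> of \<open>h(r) h(s)^{-1}\<close> satisfies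
  \<open>h r = h(as)\<close>; multiplication by \<open>w\<close> turns this into the Ore relation
  \<open>w r = (w a) s\<close>.\<close>

lemma left_Ore_set_denominators: "left_Ore_set R denominators"
proof -
  have "submonoid denominators R"
    by (rule submonoid.intro) (auto simp: mult_denominators)
  moreover have "\<zero> \<notin> denominators"
    using nontrivial unfolding denominators_def Units_def by force
  moreover have "\<exists>t\<in>denominators. \<exists>a\<in>carrier R. t \<otimes> r = a \<otimes> s"
    if r: "r \<in> carrier R" and s: "s \<in> denominators" for r s
  proof -
    obtain a where a: "a \<in> carrier R" "h a = h r \<otimes>\<^bsub>S\<^esub> inv\<^bsub>S\<^esub> (h s)"
      using preimage_of[of "h r \<otimes>\<^bsub>S\<^esub> inv\<^bsub>S\<^esub> (h s)"] r s by auto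
    then have "h r = h (a \<otimes> s)"
      using r s by (simp add: S.m_assoc)
    then have "w \<otimes> r = (w \<otimes> a) \<otimes> s"
      using w_cancel[of r "a \<otimes> s"] a r s w_closed by (simp add: R.m_assoc)
    then show ?thesis
      using a w_closed denominatorsI[OF w_closed w_unit] by (intro bexI[of _ w] bexI[of _ "w \<otimes> a"]) auto
  qed
  ultimately show ?thesis
    unfolding left_Ore_set_def multiplicative_subset_def by blast
qed

lemma ass_denominators: "ass R denominators = a_kernel R S h"
proof (intro equalityI subsetI)
  fix r assume "r \<in> ass R denominators"
  then obtain s where s: "r \<in> carrier R" "s \<in> denominators" "s \<otimes> r = \<zero>"
    unfolding ass_def by blast
  have "h s \<otimes>\<^bsub>S\<^esub> h r = h (s \<otimes> r)"
    using s(1,2) by simp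
  also have "\<dots> = h s \<otimes>\<^bsub>S\<^esub> \<zero>\<^bsub>S\<^esub>"
    unfolding s(3) using s(2) by simp
  finally have "h s \<otimes>\<^bsub>S\<^esub> h r = h s \<otimes>\<^bsub>S\<^esub> \<zero>\<^bsub>S\<^esub>" .
  then have "h r = \<zero>\<^bsub>S\<^esub>"
    using s(1,2) by (subst (asm) S.Units_l_cancel) auto
  then show "r \<in> a_kernel R S h"
    using s(1) kernel_iff by blast
next
  fix r assume "r \<in> a_kernel R S h"
  then show "r \<in> ass R denominators"
    using annihilates_kernel[of r] denominatorsI[OF w_closed w_unit]
    unfolding ass_def kernel_iff by blast
qed

lemma denominators_Den_l: "denominators \<in> Den_l R"
proof -
  have "r \<in> ass R denominators" if "r \<in> carrier R" "s \<in> denominators" "r \<otimes> s = \<zero>" for r s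
  proof -
    have "h r \<otimes>\<^bsub>S\<^esub> h s = h (r \<otimes> s)"
      using that(1,2) by simp
    then have "h r \<otimes>\<^bsub>S\<^esub> h s \<otimes>\<^bsub>S\<^esub> inv\<^bsub>S\<^esub> (h s) = \<zero>\<^bsub>S\<^esub>"
      unfolding that(3) using that(2) by simp
    then have "h r = \<zero>\<^bsub>S\<^esub>"
      using that(1,2) by (simp add: S.m_assoc)
    then show ?thesis
      using that(1) ass_denominators kernel_iff by blast
  qed
  then show ?thesis
    unfolding Den_l_def using left_Ore_set_denominators by blast
qed

lemma fraction_class_expand:
  assumes "a \<in> denominators" "s \<in> denominators" "r \<in> carrier R" "x \<in> carrier S"
  shows "(a \<otimes> s, a \<otimes> r) \<in> fraction_class x \<longleftrightarrow> (s, r) \<in> fraction_class x"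
proof -
  have "h a \<otimes>\<^bsub>S\<^esub> (h s \<otimes>\<^bsub>S\<^esub> x) = h a \<otimes>\<^bsub>S\<^esub> h r \<longleftrightarrow> h s \<otimes>\<^bsub>S\<^esub> x = h r"
    using assms by (intro S.Units_l_cancel) auto
  then show ?thesis
    using assms by (auto simp: fraction_class_def mult_denominators S.m_assoc)
qed

text \<open>Expanding factors are themselves denominators, so they preserve the value
  \<open>x\<close>; this is one inclusion. For the other, two pairs with the same value are expanded
  to a common pair by means of lifted inverses of \<open>h s\<close> and
  \<open>h s'\<close>.\<close>

lemma fraction_eq_class:
  assumes sr: "(s, r) \<in> fraction_class x" and x: "x \<in> carrier S"
  shows "fraction R denominators s r = fraction_class x"
proof (intro equalityI subrelI)
  have s: "s \<in> denominators" "r \<in> carrier R" "h s \<otimes>\<^bsub>S\<^esub> x = h r"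
    using sr by (auto simp: fraction_class_def)
  fix s' r'
  {
    assume "(s', r') \<in> fraction R denominators s r"
    then obtain c d where cd: "s' \<in> denominators" "r' \<in> carrier R" "c \<in> carrier R" "d \<in> carrier R"
      "c \<otimes> s \<in> denominators" "c \<otimes> s = d \<otimes> s'" "c \<otimes> r = d \<otimes> r'"
      by (auto simp: fraction_def fraction_rel_def)
    then have "c \<in> denominators" "d \<in> denominators"
      using s left_factor_denominators by metis+
    then show "(s', r') \<in> fraction_class x"
      using cd s sr x fraction_class_expand by metis
  next
    assume "(s', r') \<in> fraction_class x"
    then have s': "s' \<in> denominators" "r' \<in> carrier R" "h s' \<otimes>\<^bsub>S\<^esub> x = h r'"
      by (auto simp: fraction_class_def)
    obtain a where a: "a \<in> carrier R" "h a = inv\<^bsub>S\<^esub> (h s)"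
      using preimage_of[of "inv\<^bsub>S\<^esub> (h s)"] s by auto
    obtain b where b: "b \<in> carrier R" "h b = inv\<^bsub>S\<^esub> (h s')"
      using preimage_of[of "inv\<^bsub>S\<^esub> (h s')"] s' by auto
    have as: "h (a \<otimes> s) = \<one>\<^bsub>S\<^esub>" "h (b \<otimes> s') = \<one>\<^bsub>S\<^esub>"
      using a b s s' by auto
    have ar: "h (a \<otimes> r) = x" "h (b \<otimes> r') = x"
      using a b s s' x by (auto simp: s(3)[symmetric] s'(3)[symmetric] S.m_assoc[symmetric])
    have "w \<otimes> (a \<otimes> s) = w \<otimes> (b \<otimes> s')" "w \<otimes> (a \<otimes> r) = w \<otimes> (b \<otimes> r')"
      using as ar a b s s' by (auto intro!: w_cancel)
    moreover have "w \<otimes> (a \<otimes> s) \<in> denominators"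
      using as a s w_closed w_unit by (intro denominatorsI) auto
    \<comment> \<open>\<open>a s\<close> and \<open>b s'\<close> both map to the identity,
      \<open>a r\<close> and \<open>b r'\<close> both map to \<open>x\<close>; hence
      \<open>w a\<close> and \<open>w b\<close> expand the two pairs to the same pair.\<close>
    ultimately have "\<exists>c\<in>carrier R. \<exists>d\<in>carrier R.
        c \<otimes> s \<in> denominators \<and> c \<otimes> s = d \<otimes> s' \<and> c \<otimes> r = d \<otimes> r'"
      using a b s s' w_closed
      by (intro bexI[of _ "w \<otimes> a"] bexI[of _ "w \<otimes> b"]) (auto simp: R.m_assoc)
    then show "(s', r') \<in> fraction R denominators s r"
      using s s' by (auto simp: fraction_def fraction_rel_def)
  }
qed

lemma one_fraction_class_iff:
  assumes "r \<in> carrier R" "x \<in> carrier S"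
  shows "(\<one>, r) \<in> fraction_class x \<longleftrightarrow> h r = x"
  using assms by (auto simp: fraction_class_def)

lemma localization_map_eq: "r \<in> carrier R \<Longrightarrow> localization_map R denominators r = fraction_class (h r)"
  unfolding localization_map_def by (rule fraction_eq_class) (auto simp: one_fraction_class_iff)

lemma inj_on_fraction_class: "inj_on fraction_class (carrier S)"
proof (rule inj_onI)
  fix x y assume xy: "x \<in> carrier S" "y \<in> carrier S" "fraction_class x = fraction_class y"
  obtain r where "r \<in> carrier R" "h r = x"
    using xy(1) by (rule preimage_of)
  then show "x = y"
    using one_fraction_class_iff xy by metis
qed

lemma carrier_left_localization:
  "carrier (left_localization R denominators) = fraction_class ` carrier S"
proof -
  have "\<exists>x\<in>carrier S. fraction R denominators s r = fraction_class x"
    if "s \<in> denominators" "r \<in> carrier R" for s r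
    using that
    by (intro bexI[of _ "inv\<^bsub>S\<^esub> (h s) \<otimes>\<^bsub>S\<^esub> h r"] fraction_eq_class)
      (auto simp: fraction_class_def S.m_assoc[symmetric])
  moreover have "\<exists>s\<in>denominators. \<exists>r\<in>carrier R. fraction_class x = fraction R denominators s r"
    if x: "x \<in> carrier S" for x
  proof -
    obtain r where "r \<in> carrier R" "h r = x"
      using x by (rule preimage_of)
    then show ?thesis
      using localization_map_eq by (intro bexI[of _ \<one>] bexI[of _ r]) (auto simp: localization_map_def)
  qed
  ultimately show ?thesis
    unfolding left_localization_def quotient_def fraction_def by fastforce
qed

text \<open>The product is a union over all representatives and admissible choices, so two things
  are needed: all choices give one class, by
  \<open>h(t's) x y = h(t'r) y = h(a) h(t) y = h(aq)\<close>, and some choice exists.\<close>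

lemma fraction_class_mult:
  assumes "x \<in> carrier S" "y \<in> carrier S"
  shows "fraction_class x \<otimes>\<^bsub>left_localization R denominators\<^esub> fraction_class y
    = fraction_class (x \<otimes>\<^bsub>S\<^esub> y)"
proof -
  have eq: "fraction R denominators (t' \<otimes> s) (a \<otimes> q) = fraction_class (x \<otimes>\<^bsub>S\<^esub> y)"
    if "(s, r) \<in> fraction_class x" "(t, q) \<in> fraction_class y"
      and t: "t' \<in> denominators" "a \<in> carrier R" "t' \<otimes> r = a \<otimes> t" for s r t q t' a
  proof (rule fraction_eq_class)
    have s: "s \<in> denominators" "r \<in> carrier R" "h s \<otimes>\<^bsub>S\<^esub> x = h r"
      and q: "t \<in> denominators" "q \<in> carrier R" "h t \<otimes>\<^bsub>S\<^esub> y = h q"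
      using that by (auto simp: fraction_class_def)
    have "h (t' \<otimes> s) \<otimes>\<^bsub>S\<^esub> (x \<otimes>\<^bsub>S\<^esub> y) = h t' \<otimes>\<^bsub>S\<^esub> (h s \<otimes>\<^bsub>S\<^esub> x) \<otimes>\<^bsub>S\<^esub> y"
      using s(1,2) t(1,2) assms by (simp add: S.m_assoc)
    also have "\<dots> = h (t' \<otimes> r) \<otimes>\<^bsub>S\<^esub> y"
      using s(2) t(1) by (simp add: s(3))
    also have "\<dots> = h a \<otimes>\<^bsub>S\<^esub> (h t \<otimes>\<^bsub>S\<^esub> y)"
      unfolding t(3) using q(1,2) t(1,2) assms by (simp add: S.m_assoc)
    finally have "h (t' \<otimes> s) \<otimes>\<^bsub>S\<^esub> (x \<otimes>\<^bsub>S\<^esub> y) = h (a \<otimes> q)"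
      using q t by simp
    then show "(t' \<otimes> s, a \<otimes> q) \<in> fraction_class (x \<otimes>\<^bsub>S\<^esub> y)"
      using s q t by (simp add: fraction_class_def mult_denominators)
  qed (use assms in simp)
  obtain r q where "r \<in> carrier R" "h r = x" "q \<in> carrier R" "h q = y"
    using assms preimage_of by metis
  then have rq: "(\<one>, r) \<in> fraction_class x" "(\<one>, q) \<in> fraction_class y"
    "r \<in> carrier R" "\<one> \<otimes> r = r \<otimes> \<one>"
    using assms by (auto simp: one_fraction_class_iff)
  let ?F = "\<lambda>(s, r) (t, q). {fraction R denominators (t' \<otimes> s) (a \<otimes> q) | t' a.
    t' \<in> denominators \<and> a \<in> carrier R \<and> t' \<otimes> r = a \<otimes> t}"
  have coll: "V = fraction_class (x \<otimes>\<^bsub>S\<^esub> y)"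
    if "z \<in> fraction_class x" "z' \<in> fraction_class y" "V \<in> ?F z z'" for z z' V
    using that eq by (cases z, cases z') auto
  \<comment> \<open>Over the denominator \<open>\<one>\<close> on both sides,
    \<open>t' = \<one>\<close> and \<open>a = r\<close> is an admissible choice.\<close>
  have mem: "fraction R denominators (\<one> \<otimes> \<one>) (r \<otimes> q) \<in> ?F (\<one>, r) (\<one>, q)"
    unfolding prod.case mem_Collect_eq using rq one_denominators
    by (intro exI[of _ \<one>] exI[of _ r] conjI) (rule refl | assumption)+
  have "(\<Union>z\<in>fraction_class x. \<Union>z'\<in>fraction_class y. \<Union>(?F z z'))
    = fraction_class (x \<otimes>\<^bsub>S\<^esub> y)"
    by (rule UN_UN_Union_eq[where F = ?F, OF coll rq(1,2) mem])
  then show ?thesis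
    by (simp add: left_localization_def case_prod_unfold)
qed

lemma fraction_class_add:
  assumes "x \<in> carrier S" "y \<in> carrier S"
  shows "fraction_class x \<oplus>\<^bsub>left_localization R denominators\<^esub> fraction_class y
    = fraction_class (x \<oplus>\<^bsub>S\<^esub> y)"
proof -
  have eq: "fraction R denominators (a \<otimes> s) (a \<otimes> r \<oplus> b \<otimes> q) = fraction_class (x \<oplus>\<^bsub>S\<^esub> y)"
    if "(s, r) \<in> fraction_class x" "(t, q) \<in> fraction_class y"
      and t: "a \<in> carrier R" "b \<in> carrier R" "a \<otimes> s \<in> denominators" "a \<otimes> s = b \<otimes> t"
    for s r t q a b
  proof (rule fraction_eq_class)
    have s: "s \<in> denominators" "r \<in> carrier R" "h s \<otimes>\<^bsub>S\<^esub> x = h r"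
      and q: "t \<in> denominators" "q \<in> carrier R" "h t \<otimes>\<^bsub>S\<^esub> y = h q"
      using that by (auto simp: fraction_class_def)
    have "h (a \<otimes> s) \<otimes>\<^bsub>S\<^esub> (x \<oplus>\<^bsub>S\<^esub> y) = h (a \<otimes> s) \<otimes>\<^bsub>S\<^esub> x \<oplus>\<^bsub>S\<^esub> h (b \<otimes> t) \<otimes>\<^bsub>S\<^esub> y"
      using s t assms by (simp add: S.r_distr)
    also have "\<dots> = h a \<otimes>\<^bsub>S\<^esub> (h s \<otimes>\<^bsub>S\<^esub> x) \<oplus>\<^bsub>S\<^esub> h b \<otimes>\<^bsub>S\<^esub> (h t \<otimes>\<^bsub>S\<^esub> y)"
      using s q t(1,2) assms by (simp add: S.m_assoc)
    finally have "h (a \<otimes> s) \<otimes>\<^bsub>S\<^esub> (x \<oplus>\<^bsub>S\<^esub> y) = h (a \<otimes> r \<oplus> b \<otimes> q)"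
      using s q t(1,2) by simp
    then show "(a \<otimes> s, a \<otimes> r \<oplus> b \<otimes> q) \<in> fraction_class (x \<oplus>\<^bsub>S\<^esub> y)"
      using s q t by (simp add: fraction_class_def)
  qed (use assms in simp)
  obtain r q where "r \<in> carrier R" "h r = x" "q \<in> carrier R" "h q = y"
    using assms preimage_of by metis
  then have rq: "(\<one>, r) \<in> fraction_class x" "(\<one>, q) \<in> fraction_class y"
    using assms by (auto simp: one_fraction_class_iff)
  let ?F = "\<lambda>(s, r) (t, q). {fraction R denominators (a \<otimes> s) (a \<otimes> r \<oplus> b \<otimes> q) | a b.
    a \<in> carrier R \<and> b \<in> carrier R \<and> a \<otimes> s \<in> denominators \<and> a \<otimes> s = b \<otimes> t}"
  have coll: "V = fraction_class (x \<oplus>\<^bsub>S\<^esub> y)"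
    if "z \<in> fraction_class x" "z' \<in> fraction_class y" "V \<in> ?F z z'" for z z' V
    using that eq by (cases z, cases z') auto
  have mem: "fraction R denominators (\<one> \<otimes> \<one>) (\<one> \<otimes> r \<oplus> \<one> \<otimes> q) \<in> ?F (\<one>, r) (\<one>, q)"
    unfolding prod.case mem_Collect_eq
    using mult_denominators[OF one_denominators one_denominators] R.one_closed
    by (intro exI[of _ \<one>] conjI) (rule refl | assumption)+
  have "(\<Union>z\<in>fraction_class x. \<Union>z'\<in>fraction_class y. \<Union>(?F z z'))
    = fraction_class (x \<oplus>\<^bsub>S\<^esub> y)"
    by (rule UN_UN_Union_eq[where F = ?F, OF coll rq(1,2) mem])
  then show ?thesis
    by (simp add: left_localization_def case_prod_unfold)
qed

lemma fraction_class_iso: "fraction_class \<in> ring_iso S (left_localization R denominators)"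
proof (rule ring_iso_memI)
  show "fraction_class \<one>\<^bsub>S\<^esub> = \<one>\<^bsub>left_localization R denominators\<^esub>"
    using localization_map_eq[of \<one>] by (simp add: localization_map_def left_localization_def)
qed (auto simp: carrier_left_localization fraction_class_mult fraction_class_add
    bij_betw_def inj_on_fraction_class)

text \<open>Membership in \<open>ring_iso\<close> says nothing about the zero of the target, which
  is a free record field until the target is known to be a ring. It is therefore matched separately
  before the ring structure is transported.\<close>

lemma ring_left_localization: "ring (left_localization R denominators)"
proof -
  have "fraction_class \<zero>\<^bsub>S\<^esub> = \<zero>\<^bsub>left_localization R denominators\<^esub>"
    using localization_map_eq[of \<zero>] by (simp add: localization_map_def left_localization_def)
  then show ?thesis
    using S.ring_iso_imp_img_ring[OF fraction_class_iso] by simp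
qed

text \<open>On \<open>carrier R\<close> the localization map is \<open>fraction_class\<close> after
  \<open>h\<close>: injectivity of the former gives it the kernel of \<open>h\<close>, surjectivity
  of \<open>h\<close> makes it onto, and the first isomorphism theorem applies.\<close>

lemma canonical_map_iso:
  "canonical_map R denominators \<in> ring_iso (R Quot a_kernel R S h) (left_localization R denominators)"
proof -
  let ?L = "left_localization R denominators"
  let ?l = "localization_map R denominators"
  have hom: "?l \<in> ring_hom R ?L"
    using fraction_class_iso unfolding ring_iso_def
    by (auto intro!: ring_hom_memI simp: localization_map_eq ring_hom_def)
  interpret L: ring_hom_ring R ?L ?l
    using hom R.ring_axioms ring_left_localization by (intro ring_hom_ringI2)
  have "?l r = \<zero>\<^bsub>?L\<^esub> \<longleftrightarrow> h r = \<zero>\<^bsub>S\<^esub>" if "r \<in> carrier R" for r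
    using that L.hom_zero inj_on_eq_iff[OF inj_on_fraction_class, of "h r" "\<zero>\<^bsub>S\<^esub>"]
    by (metis R.zero_closed S.zero_closed hom_closed hom_zero localization_map_eq)
  then have "a_kernel R ?L ?l = a_kernel R S h"
    unfolding a_kernel_def' by blast
  moreover have "?l ` carrier R = carrier ?L"
    unfolding carrier_left_localization surj[symmetric] image_image
    by (rule image_cong) (auto simp: localization_map_eq)
  ultimately show ?thesis
    using L.FactRing_iso_set unfolding canonical_map_def by simp
qed

end

section \<open>The Jacobson radical and left Artinian rings\<close>

context ring
begin

lemma left_idealI:
  assumes "I \<subseteq> carrier R" "\<zero> \<in> I"
    and add: "\<And>x y. \<lbrakk>x \<in> I; y \<in> I\<rbrakk> \<Longrightarrow> x \<oplus> y \<in> I"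
    and mult: "\<And>r x. \<lbrakk>r \<in> carrier R; x \<in> I\<rbrakk> \<Longrightarrow> r \<otimes> x \<in> I"
  shows "left_ideal R I"
proof -
  have "\<ominus> x \<in> I" if "x \<in> I" for x
  proof -
    have "\<ominus> x = (\<ominus> \<one>) \<otimes> x"
      using that assms(1) by (auto simp: l_minus)
    then show ?thesis
      using mult[of "\<ominus> \<one>" x] that by simp
  qed
  then have "additive_subgroup I R"
    using assms by (intro additive_subgroupI subgroup.intro) (auto simp: a_inv_def)
  then show ?thesis
    using mult by (simp add: left_ideal_def)
qed

lemma left_idealD:
  assumes "left_ideal R I"
  shows "I \<subseteq> carrier R" "\<zero> \<in> I"
    and "\<And>x y. \<lbrakk>x \<in> I; y \<in> I\<rbrakk> \<Longrightarrow> x \<oplus> y \<in> I"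
    and "\<And>r x. \<lbrakk>r \<in> carrier R; x \<in> I\<rbrakk> \<Longrightarrow> r \<otimes> x \<in> I"
    and "\<And>x. x \<in> I \<Longrightarrow> \<ominus> x \<in> I"
proof -
  interpret additive_subgroup I R
    using assms by (simp add: left_ideal_def)
  show "I \<subseteq> carrier R" "\<zero> \<in> I" "\<And>x y. \<lbrakk>x \<in> I; y \<in> I\<rbrakk> \<Longrightarrow> x \<oplus> y \<in> I" "\<And>x. x \<in> I \<Longrightarrow> \<ominus> x \<in> I"
    using a_subset a_inv_closed by auto
  show "\<And>r x. \<lbrakk>r \<in> carrier R; x \<in> I\<rbrakk> \<Longrightarrow> r \<otimes> x \<in> I"
    using assms by (simp add: left_ideal_def)
qed

lemma left_ideal_one: "\<lbrakk>left_ideal R I; \<one> \<in> I\<rbrakk> \<Longrightarrow> I = carrier R"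
  using left_idealD(1,4)[of I] by force

lemma left_ideal_principal:
  assumes "s \<in> carrier R"
  shows "left_ideal R ((\<lambda>a. a \<otimes> s) ` carrier R)"
proof (rule left_idealI)
  show "\<zero> \<in> (\<lambda>a. a \<otimes> s) ` carrier R"
    using assms by (intro image_eqI[of _ _ \<zero>]) auto
next
  fix x y assume "x \<in> (\<lambda>a. a \<otimes> s) ` carrier R" "y \<in> (\<lambda>a. a \<otimes> s) ` carrier R"
  then obtain a b where "x = a \<otimes> s" "y = b \<otimes> s" "a \<in> carrier R" "b \<in> carrier R"
    by blast
  then show "x \<oplus> y \<in> (\<lambda>a. a \<otimes> s) ` carrier R"
    using assms by (intro image_eqI[of _ _ "a \<oplus> b"]) (auto simp: l_distr)
next
  fix r x assume r: "r \<in> carrier R" and "x \<in> (\<lambda>a. a \<otimes> s) ` carrier R"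
  then obtain a where "x = a \<otimes> s" "a \<in> carrier R"
    by blast
  then show "r \<otimes> x \<in> (\<lambda>a. a \<otimes> s) ` carrier R"
    using assms r by (intro image_eqI[of _ _ "r \<otimes> a"]) (auto simp: m_assoc)
qed (use assms in auto)

text \<open>Properness in the form \<open>\<one> \<notin> I\<close> passes to unions of chains, as
  Zorn's lemma requires.\<close>

lemma maximal_left_ideal_above:
  assumes J: "left_ideal R J" "\<one> \<notin> J"
  obtains M where "maximal_left_ideal R M" "J \<subseteq> M"
proof -
  define F where "F = {I. left_ideal R I \<and> \<one> \<notin> I \<and> J \<subseteq> I}"
  have "\<Union>C \<in> F" if C: "C \<noteq> {}" "subset.chain F C" for C
  proof -
    have mem: "left_ideal R I" "\<one> \<notin> I" "J \<subseteq> I" if "I \<in> C" for I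
      using C(2) that by (auto simp: subset.chain_def F_def)
    have "left_ideal R (\<Union>C)"
    proof (rule left_idealI)
      fix x y assume "x \<in> \<Union>C" "y \<in> \<Union>C"
      then obtain A B where "A \<in> C" "B \<in> C" "x \<in> A" "y \<in> B"
        by blast
      moreover have "A \<subseteq> B \<or> B \<subseteq> A"
        using C(2) \<open>A \<in> C\<close> \<open>B \<in> C\<close> by (auto simp: subset_chain_def)
      ultimately show "x \<oplus> y \<in> \<Union>C"
        using left_idealD(3)[OF mem(1)] by blast
    next
      show "\<Union>C \<subseteq> carrier R"
        using left_idealD(1)[OF mem(1)] by blast
      obtain A where "A \<in> C"
        using C(1) by blast
      then show "\<zero> \<in> \<Union>C"
        using left_idealD(2)[OF mem(1)] by blast
    next
      fix r x assume "r \<in> carrier R" "x \<in> \<Union>C"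
      then show "r \<otimes> x \<in> \<Union>C"
        using left_idealD(4)[OF mem(1)] by blast
    qed
    then show ?thesis
      using C(1) mem(2,3) unfolding F_def by blast
  qed
  moreover have "F \<noteq> {}"
    using J by (auto simp: F_def)
  ultimately obtain M where M: "M \<in> F" "\<And>I. \<lbrakk>I \<in> F; M \<subseteq> I\<rbrakk> \<Longrightarrow> I = M"
    using subset_Zorn_nonempty[of F] by blast
  have "I = M \<or> I = carrier R" if "left_ideal R I" "M \<subseteq> I" for I
    using M that left_ideal_one[of I] by (auto simp: F_def)
  moreover have "M \<noteq> carrier R"
    using M(1) by (auto simp: F_def)
  ultimately have "maximal_left_ideal R M"
    using M(1) by (simp add: maximal_left_ideal_def F_def)
  with M(1) that show ?thesis
    by (simp add: F_def)
qed

section \<open>Units and two-sidedness for the Jacobson radical\<close>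

lemma jacobson_radical_closed: "x \<in> jacobson_radical R \<Longrightarrow> x \<in> carrier R"
  by (simp add: jacobson_radical_def)

lemma jacobson_radical_left_mult:
  "\<lbrakk>r \<in> carrier R; x \<in> jacobson_radical R\<rbrakk> \<Longrightarrow> r \<otimes> x \<in> jacobson_radical R"
  by (auto simp: jacobson_radical_def maximal_left_ideal_def left_idealD(4))

text \<open>Otherwise \<open>R(1 + x)\<close> lies in a maximal left ideal, which contains
  \<open>x\<close> as well and hence the identity.\<close>

lemma left_invertible_one_plus_radical:
  assumes x: "x \<in> jacobson_radical R"
  obtains y where "y \<in> carrier R" "y \<otimes> (\<one> \<oplus> x) = \<one>"
proof -
  let ?J = "(\<lambda>a. a \<otimes> (\<one> \<oplus> x)) ` carrier R"
  have xR: "x \<in> carrier R"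
    using x by (rule jacobson_radical_closed)
  have "\<one> \<in> ?J"
  proof (rule ccontr)
    assume "\<one> \<notin> ?J"
    then obtain M where M: "maximal_left_ideal R M" "?J \<subseteq> M"
      using maximal_left_ideal_above left_ideal_principal xR
      by (metis add.m_closed one_closed)
    have I: "left_ideal R M"
      using M(1) by (simp add: maximal_left_ideal_def)
    have "\<one> \<oplus> x \<in> M"
      using M(2) xR by (auto intro!: image_eqI[of _ _ \<one>])
    moreover have "\<ominus> x \<in> M"
      using x M(1) left_idealD(5)[OF I] by (auto simp: jacobson_radical_def)
    ultimately have "(\<one> \<oplus> x) \<oplus> \<ominus> x \<in> M"
      using left_idealD(3)[OF I] by blast
    then have "\<one> \<in> M"
      using xR by (simp add: a_assoc r_neg)
    then show False
      using left_ideal_one[OF I] M(1) by (simp add: maximal_left_ideal_def)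
  qed
  with that show ?thesis
    by force
qed

text \<open>The left inverse \<open>y\<close> of \<open>1 + x\<close> equals
  \<open>1 + (-y)x\<close>, so it has the same shape and a left inverse \<open>z\<close> of its own.
  Being invertible on both sides, \<open>y\<close> forces \<open>z = 1 + x\<close>.\<close>

lemma one_plus_radical_Units:
  assumes x: "x \<in> jacobson_radical R"
  shows "\<one> \<oplus> x \<in> Units R"
proof -
  have xR: "x \<in> carrier R"
    using x by (rule jacobson_radical_closed)
  obtain y where y: "y \<in> carrier R" "y \<otimes> (\<one> \<oplus> x) = \<one>"
    using x by (rule left_invertible_one_plus_radical)
  have "y \<oplus> y \<otimes> x = \<one>"
    using y xR by (simp add: r_distr)
  then have "y = \<one> \<oplus> (\<ominus> y) \<otimes> x"
    using y(1) xR by (metis a_assoc a_inv_closed l_minus m_closed r_neg r_zero)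
  moreover have "(\<ominus> y) \<otimes> x \<in> jacobson_radical R"
    using x y by (simp add: jacobson_radical_left_mult)
  ultimately obtain z where z: "z \<in> carrier R" "z \<otimes> y = \<one>"
    using left_invertible_one_plus_radical by metis
  then have "z = \<one> \<oplus> x"
    using y xR inv_unique[of z y "\<one> \<oplus> x"] by simp
  then show ?thesis
    using y z xR unfolding Units_def by blast
qed

text \<open>The radical is defined through left ideals, so only left multiples are immediate. If
  \<open>x r\<close> avoided a maximal \<open>M\<close>, the left ideal \<open>N\<close> of all
  \<open>y\<close> with \<open>y r \<in> M\<close> would again be maximal and hence contain
  \<open>x\<close>.\<close>

lemma jacobson_radical_right_mult:
  assumes x: "x \<in> jacobson_radical R" and r: "r \<in> carrier R"
  shows "x \<otimes> r \<in> jacobson_radical R"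
proof -
  have xR: "x \<in> carrier R"
    using x by (rule jacobson_radical_closed)
  have "x \<otimes> r \<in> M" if M: "maximal_left_ideal R M" for M
  proof (rule ccontr)
    assume out: "x \<otimes> r \<notin> M"
    have I: "left_ideal R M"
      and max: "\<And>I. \<lbrakk>left_ideal R I; M \<subseteq> I\<rbrakk> \<Longrightarrow> I = M \<or> I = carrier R"
      using M unfolding maximal_left_ideal_def by blast+
    note ID = left_idealD[OF I]
    define N where "N = {y \<in> carrier R. y \<otimes> r \<in> M}"
    have N: "left_ideal R N"
      using r ID(2) by (intro left_idealI) (auto simp: N_def l_distr m_assoc intro: ID(3,4))
    have "N' = N \<or> N' = carrier R" if N': "left_ideal R N'" "N \<subseteq> N'" for N'
    proof (rule ccontr)
      assume "\<not> (N' = N \<or> N' = carrier R)"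
      then obtain y where y: "y \<in> N'" "y \<notin> N" and proper: "\<one> \<notin> N'"
        using N' left_ideal_one by blast
      have yR: "y \<in> carrier R"
        using y(1) left_idealD(1)[OF N'(1)] by blast
      \<comment> \<open>This is \<open>M + R y r\<close>. It properly contains \<open>M\<close>, so
        it is all of \<open>R\<close>, and \<open>r\<close> itself has this form.\<close>
      let ?L = "{m \<oplus> a \<otimes> (y \<otimes> r) | m a. m \<in> M \<and> a \<in> carrier R}"
      have L1: "left_ideal R ?L"
      proof (rule left_idealI)
        show "?L \<subseteq> carrier R"
          using ID(1) yR r by auto
        have "\<zero> = \<zero> \<oplus> \<zero> \<otimes> (y \<otimes> r)"
          using yR r by simp
        then show "\<zero> \<in> ?L"
          using ID(2) by blast
      next
        fix u v assume "u \<in> ?L" "v \<in> ?L"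
        then obtain m a n b where uv: "u = m \<oplus> a \<otimes> (y \<otimes> r)" "v = n \<oplus> b \<otimes> (y \<otimes> r)"
          "m \<in> M" "n \<in> M" "a \<in> carrier R" "b \<in> carrier R"
          by blast
        moreover have "m \<in> carrier R" "n \<in> carrier R"
          using uv ID(1) by auto
        ultimately have "u \<oplus> v = (m \<oplus> n) \<oplus> (a \<oplus> b) \<otimes> (y \<otimes> r)"
          using yR r by (simp add: l_distr a_ac)
        then show "u \<oplus> v \<in> ?L"
          using uv ID(3) by blast
      next
        fix u v assume u: "u \<in> carrier R" and "v \<in> ?L"
        then obtain n b where v: "v = n \<oplus> b \<otimes> (y \<otimes> r)" "n \<in> M" "b \<in> carrier R"
          by blast
        moreover have "n \<in> carrier R"
          using v ID(1) by auto
        ultimately have "u \<otimes> v = u \<otimes> n \<oplus> (u \<otimes> b) \<otimes> (y \<otimes> r)"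
          using u yR r by (simp add: r_distr m_assoc)
        then show "u \<otimes> v \<in> ?L"
          using u v ID(4) by blast
      qed
      have L2: "M \<subseteq> ?L"
      proof
        fix m assume "m \<in> M"
        moreover have "m = m \<oplus> \<zero> \<otimes> (y \<otimes> r)"
          using \<open>m \<in> M\<close> ID(1) yR r by auto
        ultimately show "m \<in> ?L"
          by blast
      qed
      have L3: "y \<otimes> r \<in> ?L"
      proof -
        have "y \<otimes> r = \<zero> \<oplus> \<one> \<otimes> (y \<otimes> r)"
          using yR r by simp
        then show ?thesis
          using ID(2) by blast
      qed
      have L4: "y \<otimes> r \<notin> M"
        using y yR by (simp add: N_def)
      from max[OF L1 L2] have "?L = carrier R"
      proof (elim disjE)
        assume "?L = M"
        then show ?thesis
          using L3 L4 by (simp only:)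
      qed
      with r obtain m a where ma: "r = m \<oplus> a \<otimes> (y \<otimes> r)" "m \<in> M" "a \<in> carrier R"
        by blast
      have mR: "m \<in> carrier R"
        using ma ID(1) by blast
      \<comment> \<open>From \<open>r = m + a y r\<close> it follows that \<open>(1 - a y) r\<close>
        lies in \<open>M\<close>, that is, \<open>1 - a y\<close> lies in \<open>N\<close>. Adding
        \<open>a y\<close> puts the identity into \<open>N'\<close>.\<close>
      have "(\<one> \<ominus> a \<otimes> y) \<otimes> r = r \<ominus> a \<otimes> (y \<otimes> r)"
        using ma(3) yR r by (simp add: minus_eq l_distr l_minus m_assoc)
      also have "\<dots> = (m \<oplus> a \<otimes> (y \<otimes> r)) \<ominus> a \<otimes> (y \<otimes> r)"
        using ma(1) by (rule arg_cong)
      also have "\<dots> = m"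
        using mR ma(3) yR r by (simp add: minus_eq a_assoc r_neg)
      finally have "\<one> \<ominus> a \<otimes> y \<in> N"
        using ma(2,3) yR by (simp add: N_def)
      then have "(\<one> \<ominus> a \<otimes> y) \<oplus> a \<otimes> y \<in> N'"
        using N'(2) left_idealD(3)[OF N'(1)] left_idealD(4)[OF N'(1) ma(3) y(1)] by blast
      then show False
        using proper ma(3) yR by (simp add: minus_eq a_assoc l_neg)
    qed
    moreover have "N \<noteq> carrier R"
      using xR out by (auto simp: N_def)
    ultimately have "x \<in> N"
      using x N by (simp add: jacobson_radical_def maximal_left_ideal_def)
    then show False
      using out by (simp add: N_def)
  qed
  then show ?thesis
    using xR r by (simp add: jacobson_radical_def)
qed

lemma ideal_jacobson_radical: "ideal (jacobson_radical R) R"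
proof (rule idealI)
  have "left_ideal R (jacobson_radical R)"
    by (rule left_idealI)
      (auto simp: jacobson_radical_def maximal_left_ideal_def left_idealD(2-4))
  then show "subgroup (jacobson_radical R) (add_monoid R)"
    by (simp add: left_ideal_def additive_subgroup_def)
qed (auto simp: jacobson_radical_left_mult jacobson_radical_right_mult ring_axioms)

end

text \<open>\<open>K\<close> is the left annihilator of \<open>R(1 - f)\<close>, a two-sided ideal
  containing \<open>f\<close>. If it is zero then \<open>f = 0\<close>; if it is everything, it
  contains the identity, and \<open>f = 1\<close>.\<close>

lemma (in simple_artinian_ring) right_semicentral_trivial:
  assumes f: "f \<in> carrier R" "\<And>x. x \<in> carrier R \<Longrightarrow> f \<otimes> x \<otimes> f = f \<otimes> x"
  shows "f = \<zero> \<or> f = \<one>"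
proof -
  define K where "K = {x \<in> carrier R. \<forall>y\<in>carrier R. x \<otimes> y \<otimes> f = x \<otimes> y}"
  have "ideal K R"
  proof (rule idealI)
    have "left_ideal R K"
      by (rule left_idealI) (use f(1) in \<open>auto simp: K_def l_distr m_assoc\<close>)
    then show "subgroup K (add_monoid R)"
      by (simp add: left_ideal_def additive_subgroup_def)
  next
    fix a x assume "a \<in> K" "x \<in> carrier R"
    moreover from this have "a \<otimes> (x \<otimes> y) \<otimes> f = a \<otimes> (x \<otimes> y)" if "y \<in> carrier R" for y
      using that by (simp add: K_def)
    ultimately show "a \<otimes> x \<in> K"
      by (simp add: K_def m_assoc)
  qed (use f(1) in \<open>auto simp: K_def m_assoc ring_axioms\<close>)
  then consider "K = {\<zero>}" | "K = carrier R"
    using simple by blast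
  then show ?thesis
  proof cases
    case 1
    have "f \<in> K"
      using f by (simp add: K_def)
    with 1 show ?thesis
      by simp
  next
    case 2
    then have "\<one> \<in> K"
      by simp
    then have "\<one> \<otimes> \<one> \<otimes> f = \<one> \<otimes> \<one>"
      unfolding K_def by blast
    then show ?thesis
      using f(1) by simp
  qed
qed

section \<open>The idempotent attached to a left denominator set\<close>

context left_artinian_ring
begin

text \<open>The chain condition is stated for sequences. Without a minimal member, a choice function
  \<open>g\<close> descends strictly inside \<open>F\<close>, and its iterates form a sequence that
  never becomes stationary.\<close>

lemma minimal_left_ideal:
  assumes F: "F \<noteq> {}" "\<And>I. I \<in> F \<Longrightarrow> left_ideal R I"
  obtains M where "M \<in> F" "\<And>I. \<lbrakk>I \<in> F; I \<subseteq> M\<rbrakk> \<Longrightarrow> I = M"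
proof (rule ccontr)
  assume "\<not> thesis"
  then have "\<forall>M\<in>F. \<exists>I\<in>F. I \<subset> M"
    using that by blast
  then obtain g where g: "\<And>M. M \<in> F \<Longrightarrow> g M \<in> F \<and> g M \<subset> M"
    by metis
  obtain M0 where M0: "M0 \<in> F"
    using F by blast
  have mem: "(g ^^ n) M0 \<in> F" for n
    by (induction n) (auto simp: M0 g)
  then have sub: "(g ^^ Suc n) M0 \<subset> (g ^^ n) M0" for n
    using g by simp
  have "\<exists>n. \<forall>m\<ge>n. (g ^^ m) M0 = (g ^^ n) M0"
    by (rule descending_chain) (use F(2) mem sub in blast)+
  then show False
    using sub by (metis le_Suc_eq less_irrefl order_refl)
qed

text \<open>The last clause is invertibility of \<open>t\<close> modulo the right annihilator of
  \<open>f\<close>. It avoids the quotient ring because \<open>f\<close> is later exchanged for an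
  idempotent with a possibly larger annihilator, and equations pass through that exchange
  directly.\<close>

lemma Den_l_idempotent:
  assumes D: "D \<in> Den_l R"
  obtains f where "f \<in> carrier R" "f \<noteq> \<zero>" "f \<otimes> f = f"
    "\<And>x. x \<in> carrier R \<Longrightarrow> f \<otimes> x \<otimes> f = f \<otimes> x"
    "\<And>t. t \<in> D \<Longrightarrow> \<exists>x\<in>carrier R. f \<otimes> (x \<otimes> t) = f \<and> f \<otimes> (t \<otimes> x) = f"
proof -
  have DR: "t \<in> carrier R" if "t \<in> D" for t
    using D that submonoid.subset
    by (auto simp: Den_l_def left_Ore_set_def multiplicative_subset_def)
  have Dmult: "t \<otimes> t' \<in> D" if "t \<in> D" "t' \<in> D" for t t'
    using D that submonoid.m_closed
    by (auto simp: Den_l_def left_Ore_set_def multiplicative_subset_def)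
  have D10: "\<one> \<in> D" "\<zero> \<notin> D"
    using D submonoid.one_closed
    by (auto simp: Den_l_def left_Ore_set_def multiplicative_subset_def)
  have Ore: "\<exists>t'\<in>D. \<exists>a\<in>carrier R. t' \<otimes> r = a \<otimes> t" if "r \<in> carrier R" "t \<in> D" for r t
  proof -
    have "{t' \<otimes> r |t'. t' \<in> D} \<inter> {a \<otimes> t |a. a \<in> carrier R} \<noteq> {}"
      using D that unfolding Den_l_def left_Ore_set_def by blast
    then show ?thesis
      by blast
  qed
  have den: "r \<in> ass R D" if "r \<in> carrier R" "t \<in> D" "r \<otimes> t = \<zero>" for r t
    using D that unfolding Den_l_def by blast
  have assD: "\<exists>t\<in>D. t \<otimes> r = \<zero>" "r \<in> carrier R" if "r \<in> ass R D" for r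
    using that unfolding ass_def by blast+
  let ?P = "\<lambda>s. (\<lambda>a. a \<otimes> s) ` carrier R"
  obtain M where M: "M \<in> ?P ` D" "\<And>I. \<lbrakk>I \<in> ?P ` D; I \<subseteq> M\<rbrakk> \<Longrightarrow> I = M"
    by (rule minimal_left_ideal[of "?P ` D"]) (use D10 DR left_ideal_principal in blast)+
  then obtain s where s: "s \<in> D" "M = ?P s"
    by blast
  have sR [simp]: "s \<in> carrier R"
    using s(1) by (rule DR)
  \<comment> \<open>\<open>R t s\<close> is contained in \<open>R s\<close>, and \<open>t s\<close>
    lies in \<open>D\<close> again, so minimality gives equality.\<close>
  have gen: "\<exists>c\<in>carrier R. s = c \<otimes> (t \<otimes> s)" if t: "t \<in> D" for t
  proof -
    have "?P (t \<otimes> s) \<subseteq> ?P s"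
    proof clarify
      fix a assume "a \<in> carrier R"
      then show "a \<otimes> (t \<otimes> s) \<in> ?P s"
        using DR[OF t] by (intro image_eqI[of _ _ "a \<otimes> t"]) (auto simp: m_assoc)
    qed
    then have "?P (t \<otimes> s) = ?P s"
      using M(2)[of "?P (t \<otimes> s)"] Dmult[OF t s(1)] s(2) by blast
    moreover have "s \<in> ?P s"
      by (intro image_eqI[of _ _ \<one>]) auto
    ultimately show ?thesis
      by blast
  qed
  \<comment> \<open>The Ore relation \<open>t' s = a t\<close> gives
    \<open>s = c t' s = c a t\<close>, so \<open>s\<close> kills whatever \<open>t\<close> kills.
    One element thus annihilates all of \<open>ass R D\<close>.\<close>
  have kill: "s \<otimes> r = \<zero>" if r: "r \<in> ass R D" for r
  proof -
    note [simp] = assD(2)[OF r]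
    obtain t where t: "t \<in> D" "t \<otimes> r = \<zero>"
      using assD(1)[OF r] by blast
    obtain t' a where a: "t' \<in> D" "a \<in> carrier R" "t' \<otimes> s = a \<otimes> t"
      using Ore[OF sR t(1)] by blast
    obtain c where c: "c \<in> carrier R" "s = c \<otimes> (t' \<otimes> s)"
      using gen[OF a(1)] by blast
    have "s \<otimes> r = (c \<otimes> (a \<otimes> t)) \<otimes> r"
      using c(2) a(3) by simp
    also have "\<dots> = c \<otimes> (a \<otimes> (t \<otimes> r))"
      using c(1) a(2) DR[OF t(1)] by (simp add: m_assoc)
    also have "\<dots> = \<zero>"
      unfolding t(2) using c(1) a(2) by simp
    finally show ?thesis .
  qed
  have left: "x \<otimes> r \<in> ass R D" if x: "x \<in> carrier R" and r: "r \<in> ass R D" for x r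
  proof -
    note [simp] = assD(2)[OF r] x
    obtain t where t: "t \<in> D" "t \<otimes> r = \<zero>"
      using assD(1)[OF r] by blast
    obtain t' a where a: "t' \<in> D" "a \<in> carrier R" "t' \<otimes> x = a \<otimes> t"
      using Ore[OF x t(1)] by blast
    have "t' \<otimes> (x \<otimes> r) = (t' \<otimes> x) \<otimes> r"
      using DR[OF a(1)] by (simp add: m_assoc)
    also have "\<dots> = a \<otimes> (t \<otimes> r)"
      unfolding a(3) using a(2) DR[OF t(1)] by (simp add: m_assoc)
    also have "\<dots> = \<zero>"
      unfolding t(2) using a(2) by simp
    finally show ?thesis
      using a(1) unfolding ass_def by auto
  qed
  obtain c where c [simp]: "c \<in> carrier R" and css: "s = c \<otimes> (s \<otimes> s)"
    using gen[OF s(1)] by blast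
  define f where "f = c \<otimes> s"
  have fR [simp]: "f \<in> carrier R"
    by (simp add: f_def)
  have eq_iff: "x \<ominus> y = \<zero> \<longleftrightarrow> x = y" if "x \<in> carrier R" "y \<in> carrier R" for x y
    using that by (rule r_right_minus_eq)
  have "f \<otimes> s = s"
    using css by (simp add: f_def m_assoc)
  \<comment> \<open>By the denominator condition, \<open>1 - f\<close> lies in
    \<open>ass R D\<close>, and \<open>kill\<close> then moves \<open>s\<close> to the other side:
    \<open>f s = s\<close> yields \<open>s f = s\<close>.\<close>
  then have "(\<one> \<ominus> f) \<otimes> s = \<zero>"
    by (simp add: minus_eq l_distr l_minus r_neg)
  then have "s \<otimes> (\<one> \<ominus> f) = \<zero>"
    using kill den s(1) by simp
  then have sf: "s \<otimes> f = s"
    using eq_iff[of s "s \<otimes> f"] by (simp add: minus_eq r_distr r_minus)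
  have ff: "f \<otimes> f = f"
    using sf by (simp add: f_def m_assoc)
  have ker: "r \<in> ass R D \<longleftrightarrow> f \<otimes> r = \<zero>" if r: "r \<in> carrier R" for r
  proof
    assume "r \<in> ass R D"
    then show "f \<otimes> r = \<zero>"
      using kill r by (simp add: f_def m_assoc)
  next
    assume fr: "f \<otimes> r = \<zero>"
    have "s \<otimes> r = s \<otimes> (f \<otimes> r)"
      using r sf by (simp add: m_assoc[symmetric])
    then have "s \<otimes> r = \<zero>"
      using fr by simp
    then show "r \<in> ass R D"
      using r s(1) by (auto simp: ass_def)
  qed
  have fxf: "f \<otimes> x \<otimes> f = f \<otimes> x" if x: "x \<in> carrier R" for x
  proof -
    \<comment> \<open>This places \<open>1 - f\<close> in \<open>ass R D\<close>, which is stable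
      under left multiplication, so \<open>f x (1 - f) = 0\<close> as well.\<close>
    have "f \<otimes> (\<one> \<ominus> f) = \<zero>"
      using ff by (simp add: minus_eq r_distr r_minus r_neg)
    then have "f \<otimes> (x \<otimes> (\<one> \<ominus> f)) = \<zero>"
      using ker[of "\<one> \<ominus> f"] ker[of "x \<otimes> (\<one> \<ominus> f)"] left[OF x, of "\<one> \<ominus> f"] x by simp
    then show ?thesis
      using eq_iff[of "f \<otimes> x" "f \<otimes> x \<otimes> f"] x by (simp add: minus_eq r_distr r_minus m_assoc ff)
  qed
  have "f \<noteq> \<zero>"
    using sf s(1) D10(2) by force
  moreover have "\<exists>x\<in>carrier R. f \<otimes> (x \<otimes> t) = f \<and> f \<otimes> (t \<otimes> x) = f" if t: "t \<in> D" for t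
  proof -
    note [simp] = DR[OF t]
    obtain x where x [simp]: "x \<in> carrier R" and xts: "s = x \<otimes> (t \<otimes> s)"
      using gen[OF t] by blast
    have "(\<one> \<ominus> x \<otimes> t) \<otimes> s = \<zero>"
      using xts by (simp add: minus_eq l_distr l_minus m_assoc r_neg)
    then have "f \<otimes> (\<one> \<ominus> x \<otimes> t) = \<zero>"
      using den[of "\<one> \<ominus> x \<otimes> t" s] s(1) ker by simp
    then have xt: "f \<otimes> (x \<otimes> t) = f"
      using eq_iff[of f "f \<otimes> (x \<otimes> t)"] by (simp add: minus_eq r_distr r_minus)
    \<comment> \<open>The left inverse \<open>x\<close> is also a right inverse:
      \<open>f t x t = f t f x t = f t f = f t\<close>, after which the denominator condition
      cancels \<open>t\<close> on the right.\<close>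
    have "f \<otimes> (t \<otimes> (x \<otimes> t)) = (f \<otimes> t \<otimes> f) \<otimes> (x \<otimes> t)"
      by (simp add: fxf) (simp add: m_assoc)
    also have "\<dots> = f \<otimes> t \<otimes> (f \<otimes> (x \<otimes> t))"
      by (simp add: m_assoc)
    also have "\<dots> = f \<otimes> t"
      unfolding xt by (simp add: fxf)
    finally have "f \<otimes> (t \<otimes> x \<ominus> \<one>) \<otimes> t = \<zero>"
      by (simp add: minus_eq l_distr r_distr l_minus r_minus m_assoc r_neg)
    then have "f \<otimes> (f \<otimes> (t \<otimes> x \<ominus> \<one>)) = \<zero>"
      using den[of "f \<otimes> (t \<otimes> x \<ominus> \<one>)" t] t ker by simp
    then have "f \<otimes> (t \<otimes> x \<ominus> \<one>) = \<zero>"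
      using ff by (simp add: m_assoc[symmetric])
    then have "f \<otimes> (t \<otimes> x) = f"
      using eq_iff[of "f \<otimes> (t \<otimes> x)" f] by (simp add: minus_eq r_distr r_minus)
    with xt show ?thesis
      using x by blast
  qed
  ultimately show ?thesis
    using that fR ff fxf by blast
qed

end

section \<open>Right semicentral idempotents\<close>

text \<open>The equation expresses \<open>e R (1 - e) = 0\<close> without subtraction; its instance
  \<open>x = \<one>\<close> yields that \<open>e\<close> is idempotent.\<close>

definition right_semicentral :: "('a, 'm) ring_scheme \<Rightarrow> 'a \<Rightarrow> bool" where
  "right_semicentral R e \<longleftrightarrow>
     e \<in> carrier R \<and> (\<forall>x\<in>carrier R. e \<otimes>\<^bsub>R\<^esub> x \<otimes>\<^bsub>R\<^esub> e = e \<otimes>\<^bsub>R\<^esub> x)"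

context ring
begin

lemma right_semicentral_closed: "right_semicentral R e \<Longrightarrow> e \<in> carrier R"
  by (simp add: right_semicentral_def)

lemma right_semicentral_mult: "\<lbrakk>right_semicentral R e; x \<in> carrier R\<rbrakk> \<Longrightarrow> e \<otimes> x \<otimes> e = e \<otimes> x"
  by (simp add: right_semicentral_def)

lemma right_semicentral_idem: "right_semicentral R e \<Longrightarrow> e \<otimes> e = e"
  using right_semicentral_mult[of e \<one>] right_semicentral_closed[of e] by simp

text \<open>An element with \<open>e r = 0\<close> equals \<open>(1 - e) r\<close>, and
  \<open>e (1 - e) = 0\<close>. Viewing \<open>(1 - e)R\<close> as an annihilator replaces coset
  arithmetic by equations with \<open>e\<close> on the left.\<close>

lemma mem_right_principal_iff:
  assumes e: "right_semicentral R e"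
  shows "r \<in> right_principal R (\<one> \<ominus> e) \<longleftrightarrow> r \<in> carrier R \<and> e \<otimes> r = \<zero>"
proof
  note [simp] = right_semicentral_closed[OF e]
  {
    assume "r \<in> right_principal R (\<one> \<ominus> e)"
    then obtain x where x: "x \<in> carrier R" "r = (\<one> \<ominus> e) \<otimes> x"
      by (auto simp: right_principal_def l_coset_def)
    have "e \<otimes> r = (e \<otimes> (\<one> \<ominus> e)) \<otimes> x"
      using x by (simp add: m_assoc)
    also have "\<dots> = \<zero>"
      using x(1) right_semicentral_idem[OF e] by (simp add: minus_eq r_distr r_minus r_neg)
    finally show "r \<in> carrier R \<and> e \<otimes> r = \<zero>"
      using x by simp
  next
    assume r: "r \<in> carrier R \<and> e \<otimes> r = \<zero>"
    then have "r = (\<one> \<ominus> e) \<otimes> r"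
      by (simp add: minus_eq l_distr l_minus)
    then show "r \<in> right_principal R (\<one> \<ominus> e)"
      using r unfolding right_principal_def l_coset_def by blast
  }
qed

text \<open>Stability under left multiplication is where right semicentrality enters:
  \<open>e a r = e a e r = 0\<close>.\<close>

lemma ideal_right_principal:
  assumes e: "right_semicentral R e"
  shows "ideal (right_principal R (\<one> \<ominus> e)) R"
proof (rule idealI)
  note [simp] = right_semicentral_closed[OF e]
  let ?K = "right_principal R (\<one> \<ominus> e)"
  have left: "a \<otimes> r \<in> ?K" if a: "a \<in> carrier R" and r: "r \<in> ?K" for a r
  proof -
    have r: "r \<in> carrier R" "e \<otimes> r = \<zero>"
      using r mem_right_principal_iff[OF e] by auto
    have "e \<otimes> (a \<otimes> r) = (e \<otimes> a \<otimes> e) \<otimes> r"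
      using a r(1) right_semicentral_mult[OF e a] by (simp add: m_assoc)
    also have "\<dots> = e \<otimes> a \<otimes> (e \<otimes> r)"
      using a r(1) by (simp add: m_assoc)
    also have "\<dots> = \<zero>"
      unfolding r(2) using a by simp
    finally show ?thesis
      using a r(1) mem_right_principal_iff[OF e] by simp
  qed
  have "left_ideal R ?K"
    by (rule left_idealI[OF _ _ _ left]) (auto simp: mem_right_principal_iff[OF e] r_distr)
  then show "subgroup ?K (add_monoid R)"
    by (simp add: left_ideal_def additive_subgroup_def)
  show "\<And>a x. \<lbrakk>a \<in> ?K; x \<in> carrier R\<rbrakk> \<Longrightarrow> x \<otimes> a \<in> ?K"
    by (rule left)
  show "\<And>a x. \<lbrakk>a \<in> ?K; x \<in> carrier R\<rbrakk> \<Longrightarrow> a \<otimes> x \<in> ?K"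
    by (auto simp: mem_right_principal_iff[OF e] m_assoc[symmetric])
qed (rule ring_axioms)

lemma right_principal_coset_eq_iff:
  assumes e: "right_semicentral R e" and "a \<in> carrier R" "b \<in> carrier R"
  shows "right_principal R (\<one> \<ominus> e) +> a = right_principal R (\<one> \<ominus> e) +> b \<longleftrightarrow>
    e \<otimes> a = e \<otimes> b"
proof -
  note [simp] = right_semicentral_closed[OF e] assms(2,3)
  have "e \<otimes> (a \<ominus> b) = e \<otimes> a \<ominus> e \<otimes> b"
    by (simp add: minus_eq r_distr r_minus)
  then show ?thesis
    using quotient_eq_iff_same_a_r_cos[OF ideal_right_principal[OF e], of a b]
      mem_right_principal_iff[OF e, of "a \<ominus> b"] by simp
qed

lemma right_principal_coset_Units:
  assumes e: "right_semicentral R e" and ux: "u \<in> carrier R" "x \<in> carrier R"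
    and inv: "e \<otimes> (x \<otimes> u) = e" "e \<otimes> (u \<otimes> x) = e"
  shows "right_principal R (\<one> \<ominus> e) +> u \<in> Units (R Quot right_principal R (\<one> \<ominus> e))"
proof -
  let ?K = "right_principal R (\<one> \<ominus> e)"
  interpret K: ideal ?K R
    by (rule ideal_right_principal[OF e])
  interpret q: ring_hom_ring R "R Quot ?K" "(+>) ?K"
    by (rule K.rcos_ring_hom_ring)
  have eq: "?K +> y = ?K +> \<one>" if "y \<in> carrier R" "e \<otimes> y = e" for y
    using right_principal_coset_eq_iff[OF e that(1) one_closed] that(2) right_semicentral_closed[OF e]
    by simp
  have "(?K +> x) \<otimes>\<^bsub>R Quot ?K\<^esub> (?K +> u) = \<one>\<^bsub>R Quot ?K\<^esub>"
    "(?K +> u) \<otimes>\<^bsub>R Quot ?K\<^esub> (?K +> x) = \<one>\<^bsub>R Quot ?K\<^esub>"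
    using eq[of "x \<otimes> u"] eq[of "u \<otimes> x"] inv ux by simp_all
  then show ?thesis
    using ux q.hom_closed unfolding Units_def by blast
qed

end

lemma (in monoid) idempotent_Unit: "\<lbrakk>x \<in> Units G; x \<otimes> x = x\<rbrakk> \<Longrightarrow> x = \<one>"
  using Units_l_cancel[of x x \<one>] Units_closed[of x] by simp

section \<open>Preimages of the units of \<open>R/(1 - e)R\<close>\<close>

context ring
begin

text \<open>For nonzero right semicentral \<open>e\<close> this is \<open>denominators\<close> for
  the coset map; as a function of \<open>e\<close> it can be taken over a whole family of
  idempotents.\<close>

definition quotient_units :: "'a \<Rightarrow> 'a set" where
  "quotient_units e = {u \<in> carrier R.
     right_principal R (\<one> \<ominus> e) +> u \<in> Units (R Quot right_principal R (\<one> \<ominus> e))}"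

lemma right_principal_coset_zero_iff:
  assumes "right_semicentral R e" "x \<in> carrier R"
  shows "right_principal R (\<one> \<ominus> e) +> x = \<zero>\<^bsub>R Quot right_principal R (\<one> \<ominus> e)\<^esub> \<longleftrightarrow> e \<otimes> x = \<zero>"
proof -
  interpret q: ring_hom_ring R "R Quot right_principal R (\<one> \<ominus> e)" "(+>) (right_principal R (\<one> \<ominus> e))"
    by (rule ideal.rcos_ring_hom_ring[OF ideal_right_principal[OF assms(1)]])
  show ?thesis
    using right_principal_coset_eq_iff[OF assms zero_closed] right_semicentral_closed[OF assms(1)]
    by simp
qed

text \<open>The idempotent itself serves as \<open>w\<close>: it is congruent to the identity modulo
  \<open>(1 - e)R\<close>, and it annihilates that ideal.\<close>

lemma unit_preimage_right_principal:
  assumes e: "right_semicentral R e" and e0: "e \<noteq> \<zero>"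
  shows "unit_preimage R (R Quot right_principal R (\<one> \<ominus> e)) ((+>) (right_principal R (\<one> \<ominus> e))) e"
proof -
  let ?K = "right_principal R (\<one> \<ominus> e)"
  interpret q: ring_hom_ring R "R Quot ?K" "(+>) ?K"
    by (rule ideal.rcos_ring_hom_ring[OF ideal_right_principal[OF e]])
  note eR = right_semicentral_closed[OF e]
  show ?thesis
  proof unfold_locales
    show "(+>) ?K ` carrier R = carrier (R Quot ?K)"
      unfolding FactRing_def A_RCOSETS_def' by auto
    show "\<one>\<^bsub>R Quot ?K\<^esub> \<noteq> \<zero>\<^bsub>R Quot ?K\<^esub>"
      using right_principal_coset_zero_iff[OF e one_closed] e0 eR by simp
    show "?K +> e \<in> Units (R Quot ?K)"
      using eR right_semicentral_idem[OF e] by (intro right_principal_coset_Units[OF e _ one_closed]) auto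
  qed (use eR right_principal_coset_zero_iff[OF e] in auto)
qed

lemma quotient_units_localization:
  assumes e: "right_semicentral R e" and e0: "e \<noteq> \<zero>"
  shows "quotient_units e \<in> Den_l R"
    and "ass R (quotient_units e) = right_principal R (\<one> \<ominus> e)"
    and "\<exists>f. f \<in> ring_iso (R Quot right_principal R (\<one> \<ominus> e)) (left_localization R (quotient_units e))"
proof -
  let ?K = "right_principal R (\<one> \<ominus> e)"
  interpret q: unit_preimage R "R Quot ?K" "(+>) ?K" e
    by (rule unit_preimage_right_principal[OF e e0])
  have eq: "quotient_units e = q.denominators"
    unfolding quotient_units_def q.denominators_def by (rule refl)
  show "quotient_units e \<in> Den_l R"
    unfolding eq by (rule q.denominators_Den_l)
  show "ass R (quotient_units e) = right_principal R (\<one> \<ominus> e)"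
    unfolding eq q.ass_denominators
    by (rule Set.set_eqI) (simp only: q.kernel_iff mem_right_principal_iff[OF e]
        right_principal_coset_zero_iff[OF e] cong: conj_cong)
  show "\<exists>f. f \<in> ring_iso (R Quot right_principal R (\<one> \<ominus> e)) (left_localization R (quotient_units e))"
    unfolding eq using q.fraction_class_iso by blast
qed

lemma mem_quotient_units: "right_semicentral R e \<Longrightarrow> e \<in> quotient_units e"
  using right_principal_coset_Units[of e e \<one>] right_semicentral_idem[of e] right_semicentral_closed[of e]
  by (simp add: quotient_units_def)

text \<open>The only idempotent unit is the identity, so \<open>f\<close> is congruent to it modulo
  \<open>(1 - e)R\<close>. Together with \<open>mem_quotient_units\<close> this separates the sets
  belonging to orthogonal idempotents.\<close>

lemma idempotent_mem_quotient_units: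
  assumes e: "right_semicentral R e" and f: "f \<in> quotient_units e" "f \<otimes> f = f"
  shows "e \<otimes> f = e"
proof -
  let ?K = "right_principal R (\<one> \<ominus> e)"
  interpret q: ring_hom_ring R "R Quot ?K" "(+>) ?K"
    by (rule ideal.rcos_ring_hom_ring[OF ideal_right_principal[OF e]])
  have fR: "f \<in> carrier R" and u: "?K +> f \<in> Units (R Quot ?K)"
    using f(1) by (auto simp: quotient_units_def)
  have "(?K +> f) \<otimes>\<^bsub>R Quot ?K\<^esub> (?K +> f) = ?K +> f"
    using q.hom_mult[OF fR fR] f(2) by simp
  then have "?K +> f = ?K +> \<one>"
    using q.S.idempotent_Unit[OF u] q.hom_one by simp
  then show ?thesis
    using right_principal_coset_eq_iff[OF e fR one_closed] right_semicentral_closed[OF e] by simp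
qed

end

section \<open>Product rings and orthogonal idempotents\<close>

lemma product_ring_simps:
  "carrier (product_ring I G) = (\<Pi>\<^sub>E i\<in>I. carrier (G i))"
  "x \<otimes>\<^bsub>product_ring I G\<^esub> y = (\<lambda>i\<in>I. x i \<otimes>\<^bsub>G i\<^esub> y i)"
  "\<one>\<^bsub>product_ring I G\<^esub> = (\<lambda>i\<in>I. \<one>\<^bsub>G i\<^esub>)"
  "\<zero>\<^bsub>product_ring I G\<^esub> = (\<lambda>i\<in>I. \<zero>\<^bsub>G i\<^esub>)"
  "x \<oplus>\<^bsub>product_ring I G\<^esub> y = (\<lambda>i\<in>I. x i \<oplus>\<^bsub>G i\<^esub> y i)"
  by (simp_all add: product_ring_def)

lemma product_ring_mem: "\<lbrakk>x \<in> carrier (product_ring I G); i \<in> I\<rbrakk> \<Longrightarrow> x i \<in> carrier (G i)"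
  by (auto simp: product_ring_simps)

lemma restrict_mem_product_ring:
  "restrict f I \<in> carrier (product_ring I G) \<longleftrightarrow> (\<forall>i\<in>I. f i \<in> carrier (G i))"
  by (auto simp: product_ring_simps)

text \<open>Tuples are \<open>undefined\<close> off the index set, so agreement of the entries on
  \<open>I\<close> is enough.\<close>

lemma restrict_eq_product_ring:
  assumes "x \<in> carrier (product_ring I G)" "\<And>i. i \<in> I \<Longrightarrow> f i = x i"
  shows "restrict f I = x"
proof
  fix i
  have "x \<in> (\<Pi>\<^sub>E i\<in>I. carrier (G i))"
    using assms(1) by (simp add: product_ring_simps)
  from PiE_arb[OF this, of i] show "restrict f I i = x i"
    using assms(2)[of i] by (cases "i \<in> I") simp_all
qed

lemma ring_product_ring:
  assumes "\<And>i. i \<in> I \<Longrightarrow> ring (G i)"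
  shows "ring (product_ring I G)"
proof (rule ringI)
  let ?P = "product_ring I G"
  note rs = ring.ring_simprules[OF assms] monoid.r_one[OF ring.is_monoid[OF assms]]
  show "abelian_group ?P"
  proof (rule abelian_groupI)
    show "\<zero>\<^bsub>?P\<^esub> \<in> carrier ?P"
      by (simp add: product_ring_simps(2-5) restrict_mem_product_ring rs)
  next
    fix x y assume xyz: "x \<in> carrier ?P" "y \<in> carrier ?P"
    note m = xyz[THEN product_ring_mem]
    show "x \<oplus>\<^bsub>?P\<^esub> y \<in> carrier ?P"
      using m by (simp add: product_ring_simps(2-5) restrict_mem_product_ring rs)
  next
    fix x y z assume xyz: "x \<in> carrier ?P" "y \<in> carrier ?P" "z \<in> carrier ?P"
    note m = xyz[THEN product_ring_mem]
    show "(x \<oplus>\<^bsub>?P\<^esub> y) \<oplus>\<^bsub>?P\<^esub> z = x \<oplus>\<^bsub>?P\<^esub> (y \<oplus>\<^bsub>?P\<^esub> z)"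
      using m by (auto simp: product_ring_simps(2-5) rs intro!: restrict_ext)
  next
    fix x y assume xyz: "x \<in> carrier ?P" "y \<in> carrier ?P"
    note m = xyz[THEN product_ring_mem]
    show "x \<oplus>\<^bsub>?P\<^esub> y = y \<oplus>\<^bsub>?P\<^esub> x"
      using m by (auto simp: product_ring_simps(2-5) rs intro!: restrict_ext)
  next
    fix x assume xyz: "x \<in> carrier ?P"
    note m = xyz[THEN product_ring_mem]
    show "\<zero>\<^bsub>?P\<^esub> \<oplus>\<^bsub>?P\<^esub> x = x"
      using m by (auto simp: product_ring_simps(2-5) rs intro!: restrict_eq_product_ring[OF xyz])
  next
    fix x assume xyz: "x \<in> carrier ?P"
    note m = xyz[THEN product_ring_mem]
    show "\<exists>y\<in>carrier ?P. y \<oplus>\<^bsub>?P\<^esub> x = \<zero>\<^bsub>?P\<^esub>"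
      using m by (intro bexI[of _ "\<lambda>i\<in>I. \<ominus>\<^bsub>G i\<^esub> x i"])
        (auto simp: product_ring_simps(2-5) restrict_mem_product_ring rs intro!: restrict_ext)
  qed
  show "monoid ?P"
  proof (rule monoidI)
    show "\<one>\<^bsub>?P\<^esub> \<in> carrier ?P"
      by (simp add: product_ring_simps(2-5) restrict_mem_product_ring rs)
  next
    fix x y assume xyz: "x \<in> carrier ?P" "y \<in> carrier ?P"
    note m = xyz[THEN product_ring_mem]
    show "x \<otimes>\<^bsub>?P\<^esub> y \<in> carrier ?P"
      using m by (simp add: product_ring_simps(2-5) restrict_mem_product_ring rs)
  next
    fix x y z assume xyz: "x \<in> carrier ?P" "y \<in> carrier ?P" "z \<in> carrier ?P"
    note m = xyz[THEN product_ring_mem]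
    show "(x \<otimes>\<^bsub>?P\<^esub> y) \<otimes>\<^bsub>?P\<^esub> z = x \<otimes>\<^bsub>?P\<^esub> (y \<otimes>\<^bsub>?P\<^esub> z)"
      using m by (auto simp: product_ring_simps(2-5) rs intro!: restrict_ext)
  next
    fix x assume xyz: "x \<in> carrier ?P"
    note m = xyz[THEN product_ring_mem]
    show "\<one>\<^bsub>?P\<^esub> \<otimes>\<^bsub>?P\<^esub> x = x"
      using m by (auto simp: product_ring_simps(2-5) rs intro!: restrict_eq_product_ring[OF xyz])
  next
    fix x assume xyz: "x \<in> carrier ?P"
    note m = xyz[THEN product_ring_mem]
    show "x \<otimes>\<^bsub>?P\<^esub> \<one>\<^bsub>?P\<^esub> = x"
      using m by (auto simp: product_ring_simps(2-5) rs intro!: restrict_eq_product_ring[OF xyz])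
  qed
next
  let ?P = "product_ring I G"
  note rs = ring.ring_simprules[OF assms]
  fix x y z assume xyz: "x \<in> carrier ?P" "y \<in> carrier ?P" "z \<in> carrier ?P"
  note m = xyz[THEN product_ring_mem]
  show "(x \<oplus>\<^bsub>?P\<^esub> y) \<otimes>\<^bsub>?P\<^esub> z = x \<otimes>\<^bsub>?P\<^esub> z \<oplus>\<^bsub>?P\<^esub> y \<otimes>\<^bsub>?P\<^esub> z"
    using m by (auto simp: product_ring_simps(2-5) rs intro!: restrict_ext)
  show "z \<otimes>\<^bsub>?P\<^esub> (x \<oplus>\<^bsub>?P\<^esub> y) = z \<otimes>\<^bsub>?P\<^esub> x \<oplus>\<^bsub>?P\<^esub> z \<otimes>\<^bsub>?P\<^esub> y"
    using m by (auto simp: product_ring_simps(2-5) rs intro!: restrict_ext)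
qed

lemma product_ring_proj_hom:
  "i \<in> I \<Longrightarrow> (\<lambda>x. x i) \<in> ring_hom (product_ring I G) (G i)"
  by (rule ring_hom_memI) (auto simp: product_ring_simps)

text \<open>Inverses chosen in each factor are collected into one tuple by \<open>restrict\<close>.
  Through this equivalence the preimage of the units of a product becomes an intersection of
  preimages.\<close>

lemma Units_product_ring:
  "x \<in> Units (product_ring I G) \<longleftrightarrow>
    x \<in> carrier (product_ring I G) \<and> (\<forall>i\<in>I. x i \<in> Units (G i))"
proof
  assume x: "x \<in> Units (product_ring I G)"
  then obtain y where y: "y \<in> carrier (product_ring I G)"
    "y \<otimes>\<^bsub>product_ring I G\<^esub> x = \<one>\<^bsub>product_ring I G\<^esub>"
    "x \<otimes>\<^bsub>product_ring I G\<^esub> y = \<one>\<^bsub>product_ring I G\<^esub>"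
    and xc: "x \<in> carrier (product_ring I G)"
    unfolding Units_def by blast
  have "x i \<in> Units (G i)" if i: "i \<in> I" for i
    using fun_cong[OF y(2), of i] fun_cong[OF y(3), of i] y(1) xc i
    by (auto simp: product_ring_simps Units_def PiE_mem intro!: bexI[of _ "y i"])
  with xc show "x \<in> carrier (product_ring I G) \<and> (\<forall>i\<in>I. x i \<in> Units (G i))"
    by blast
next
  assume x: "x \<in> carrier (product_ring I G) \<and> (\<forall>i\<in>I. x i \<in> Units (G i))"
  then have "\<forall>i\<in>I. \<exists>y\<in>carrier (G i). y \<otimes>\<^bsub>G i\<^esub> x i = \<one>\<^bsub>G i\<^esub> \<and> x i \<otimes>\<^bsub>G i\<^esub> y = \<one>\<^bsub>G i\<^esub>"
    unfolding Units_def by blast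
  then obtain y where y: "\<And>i. i \<in> I \<Longrightarrow> y i \<in> carrier (G i)"
    "\<And>i. i \<in> I \<Longrightarrow> y i \<otimes>\<^bsub>G i\<^esub> x i = \<one>\<^bsub>G i\<^esub>" "\<And>i. i \<in> I \<Longrightarrow> x i \<otimes>\<^bsub>G i\<^esub> y i = \<one>\<^bsub>G i\<^esub>"
    by metis
  have "restrict y I \<in> carrier (product_ring I G)"
    "restrict y I \<otimes>\<^bsub>product_ring I G\<^esub> x = \<one>\<^bsub>product_ring I G\<^esub>"
    "x \<otimes>\<^bsub>product_ring I G\<^esub> restrict y I = \<one>\<^bsub>product_ring I G\<^esub>"
    using y by (auto simp: product_ring_simps intro!: restrict_ext)
  with x show "x \<in> Units (product_ring I G)"
    unfolding Units_def by blast
qed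

text \<open>A reindexing is built in because the factors on one side will be indexed by idempotents
  and those on the other by denominator sets. The preimage of a tuple takes its entry at
  \<open>i\<close> from the place that \<open>\<sigma>\<close> sends to \<open>i\<close>.\<close>

lemma product_ring_iso:
  assumes \<sigma>: "bij_betw \<sigma> J I"
    and \<psi>: "\<And>j. j \<in> J \<Longrightarrow> \<psi> j \<in> ring_iso (G (\<sigma> j)) (H j)"
  shows "product_ring I G \<simeq> product_ring J H"
proof -
  let ?f = "\<lambda>x. \<lambda>j\<in>J. \<psi> j (x (\<sigma> j))"
  have hom: "\<psi> j \<in> ring_hom (G (\<sigma> j)) (H j)" and bij: "bij_betw (\<psi> j) (carrier (G (\<sigma> j))) (carrier (H j))"
    if "j \<in> J" for j
    using \<psi>[OF that] by (auto simp: ring_iso_def)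
  have \<sigma>I: "\<sigma> j \<in> I" if "j \<in> J" for j
    using \<sigma> that by (rule bij_betwE[rule_format])
  have inj: "x = y" if x: "x \<in> carrier (product_ring I G)" "y \<in> carrier (product_ring I G)"
    and eq: "?f x = ?f y" for x y
  proof (rule PiE_ext)
    show "x \<in> (\<Pi>\<^sub>E i\<in>I. carrier (G i))" "y \<in> (\<Pi>\<^sub>E i\<in>I. carrier (G i))"
      using x by (simp_all add: product_ring_simps)
    fix i assume "i \<in> I"
    then obtain j where j: "j \<in> J" "i = \<sigma> j"
      using \<sigma> by (auto simp: bij_betw_def)
    have "\<psi> j (x i) = \<psi> j (y i)"
      using fun_cong[OF eq, of j] j by simp
    then show "x i = y i"
      using bij[OF j(1)] x \<open>i \<in> I\<close> j(2)
      by (auto simp: bij_betw_def product_ring_simps PiE_mem dest: inj_onD)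
  qed
  have surj: "\<exists>x\<in>carrier (product_ring I G). ?f x = y" if y: "y \<in> carrier (product_ring J H)" for y
  proof -
    let ?x = "\<lambda>i\<in>I. inv_into (carrier (G i)) (\<psi> (inv_into J \<sigma> i)) (y (inv_into J \<sigma> i))"
    have inv: "inv_into J \<sigma> i \<in> J" "\<sigma> (inv_into J \<sigma> i) = i" if "i \<in> I" for i
      using \<sigma> that by (auto simp: bij_betw_def inv_into_into f_inv_into_f)
    have img: "y j \<in> \<psi> j ` carrier (G (\<sigma> j))" if "j \<in> J" for j
      using y bij[OF that] that by (auto simp: bij_betw_def product_ring_simps PiE_mem)
    have xm: "inv_into (carrier (G i)) (\<psi> (inv_into J \<sigma> i)) (y (inv_into J \<sigma> i)) \<in> carrier (G i)"
      if "i \<in> I" for i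
      using img[OF inv(1)[OF that]] inv(2)[OF that] by (intro inv_into_into) simp
    then have "?x \<in> carrier (product_ring I G)"
      by (simp add: product_ring_simps)
    moreover have "?f ?x = y"
    proof (rule PiE_ext)
      show "?f ?x \<in> (\<Pi>\<^sub>E j\<in>J. carrier (H j))"
        using \<sigma>I ring_hom_closed[OF hom xm[OF \<sigma>I]] by auto
      show "y \<in> (\<Pi>\<^sub>E j\<in>J. carrier (H j))"
        using y by (simp add: product_ring_simps)
      fix j assume j: "j \<in> J"
      have "inv_into J \<sigma> (\<sigma> j) = j"
        using \<sigma> j by (simp add: bij_betw_def)
      then show "?f ?x j = y j"
        using j \<sigma>I[OF j] f_inv_into_f[OF img[OF j]] by simp
    qed
    ultimately show ?thesis
      by blast
  qed
  have "?f \<in> ring_iso (product_ring I G) (product_ring J H)"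
  proof (rule ring_iso_memI)
    show "?f x \<in> carrier (product_ring J H)" if "x \<in> carrier (product_ring I G)" for x
      using that \<sigma>I ring_hom_closed[OF hom] by (auto simp: product_ring_simps PiE_mem)
    then show "bij_betw ?f (carrier (product_ring I G)) (carrier (product_ring J H))"
      unfolding bij_betw_def using inj surj by (auto simp: inj_on_def image_iff) metis
  next
    fix x y assume xy: "x \<in> carrier (product_ring I G)" "y \<in> carrier (product_ring I G)"
    note m = xy[THEN product_ring_mem, OF \<sigma>I]
    show "?f (x \<otimes>\<^bsub>product_ring I G\<^esub> y) = ?f x \<otimes>\<^bsub>product_ring J H\<^esub> ?f y"
      using m by (auto simp: product_ring_simps(2-5) \<sigma>I ring_hom_mult[OF hom] intro!: restrict_ext)
    show "?f (x \<oplus>\<^bsub>product_ring I G\<^esub> y) = ?f x \<oplus>\<^bsub>product_ring J H\<^esub> ?f y"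
      using m by (auto simp: product_ring_simps(2-5) \<sigma>I ring_hom_add[OF hom] intro!: restrict_ext)
  next
    show "?f \<one>\<^bsub>product_ring I G\<^esub> = \<one>\<^bsub>product_ring J H\<^esub>"
      by (auto simp: product_ring_simps(2-5) \<sigma>I ring_hom_one[OF hom] intro!: restrict_ext)
  qed
  then show ?thesis
    unfolding is_ring_iso_def by blast
qed

section \<open>Finite orthogonal families and the Chinese remainder theorem\<close>

locale orthogonal_right_semicentral = ring R for R (structure) +
  fixes M
  assumes finite_M: "finite M" and M_nonempty: "M \<noteq> {}"
    and semicentral: "e \<in> M \<Longrightarrow> right_semicentral R e"
    and not_zero: "e \<in> M \<Longrightarrow> e \<noteq> \<zero>"
    and orthogonal: "\<lbrakk>e \<in> M; f \<in> M; e \<noteq> f\<rbrakk> \<Longrightarrow> e \<otimes> f = \<zero>"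
begin

lemma M_closed: "e \<in> M \<Longrightarrow> e \<in> carrier R"
  using semicentral right_semicentral_closed by blast

definition total where "total = (\<Oplus>e\<in>M. e)"

lemma total_closed [simp]: "total \<in> carrier R"
  unfolding total_def using M_closed by (intro finsum_closed) blast

text \<open>Orthogonality removes every term with \<open>f \<noteq> e\<close>. The sum is therefore
  an explicit simultaneous solution of the congruences with right-hand side \<open>r e\<close>
  modulo \<open>(1 - e)R\<close>.\<close>

lemma M_finsum:
  assumes e: "e \<in> M" and r: "\<And>f. f \<in> M \<Longrightarrow> r f \<in> carrier R"
  shows "e \<otimes> (\<Oplus>f\<in>M. f \<otimes> r f) = e \<otimes> r e"
proof -
  have "e \<otimes> (\<Oplus>f\<in>M. f \<otimes> r f) = (\<Oplus>f\<in>M. e \<otimes> (f \<otimes> r f))"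
    using M_closed e r finite_M by (intro finsum_rdistr) auto
  also have "\<dots> = (\<Oplus>f\<in>M. if e = f then e \<otimes> r f else \<zero>)"
  proof (rule finsum_cong')
    fix f assume f: "f \<in> M"
    have "e \<otimes> (f \<otimes> r f) = e \<otimes> f \<otimes> r f"
      using M_closed[OF e] M_closed[OF f] r[OF f] by (simp add: m_assoc)
    also have "e \<otimes> f = (if e = f then e else \<zero>)"
      using orthogonal[OF e f] right_semicentral_idem[OF semicentral[OF f]] by auto
    finally show "e \<otimes> (f \<otimes> r f) = (if e = f then e \<otimes> r f else \<zero>)"
      using r[OF f] by simp
  qed (use M_closed e r in auto)
  also have "\<dots> = e \<otimes> r e"
    using M_closed e r finite_M by (intro finsum_singleton) auto
  finally show ?thesis .
qed

lemma M_total: "e \<in> M \<Longrightarrow> e \<otimes> total = e"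
proof -
  assume e: "e \<in> M"
  have "(\<Oplus>f\<in>M. f \<otimes> \<one>) = total"
    unfolding total_def using M_closed by (intro finsum_cong') auto
  then show "e \<otimes> total = e"
    using M_finsum[OF e, of "\<lambda>_. \<one>"] M_closed[OF e] by simp
qed

lemma total_mult: "x \<in> carrier R \<Longrightarrow> total \<otimes> x = (\<Oplus>e\<in>M. e \<otimes> x)"
  unfolding total_def using finite_M M_closed by (intro finsum_ldistr) auto

text \<open>Because \<open>e total = e\<close>, whatever \<open>total\<close> kills is killed by
  each \<open>e\<close>; the converse is summation. For ideals: \<open>(1 - total)R\<close> is the
  intersection of the \<open>(1 - e)R\<close>.\<close>

lemma total_annihilates_iff:
  assumes x: "x \<in> carrier R"
  shows "total \<otimes> x = \<zero> \<longleftrightarrow> (\<forall>e\<in>M. e \<otimes> x = \<zero>)"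
proof
  assume tx: "total \<otimes> x = \<zero>"
  show "\<forall>e\<in>M. e \<otimes> x = \<zero>"
  proof
    fix e assume e: "e \<in> M"
    have "e \<otimes> x = e \<otimes> total \<otimes> x"
      by (simp only: M_total[OF e])
    also have "\<dots> = e \<otimes> (total \<otimes> x)"
      using M_closed[OF e] x by (simp add: m_assoc)
    also have "\<dots> = \<zero>"
      unfolding tx using M_closed[OF e] by simp
    finally show "e \<otimes> x = \<zero>" .
  qed
next
  assume "\<forall>e\<in>M. e \<otimes> x = \<zero>"
  then have "(\<Oplus>e\<in>M. e \<otimes> x) = (\<Oplus>e\<in>M. \<zero>)"
    by (intro finsum_cong') auto
  then show "total \<otimes> x = \<zero>"
    by (simp add: total_mult[OF x])
qed

text \<open>For each member \<open>e\<close>,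
  \<open>e x total = (e x e) total = e x e = e x\<close>; summation over \<open>M\<close> replaces
  the left factor \<open>e\<close> by \<open>total\<close>.\<close>

lemma right_semicentral_total: "right_semicentral R total"
proof -
  have "total \<otimes> x \<otimes> total = total \<otimes> x" if x: "x \<in> carrier R" for x
  proof -
    have "e \<otimes> (x \<otimes> total) = e \<otimes> x" if e: "e \<in> M" for e
    proof -
      have "e \<otimes> (x \<otimes> total) = (e \<otimes> x \<otimes> e) \<otimes> total"
        using M_closed[OF e] x right_semicentral_mult[OF semicentral[OF e] x] by (simp add: m_assoc)
      also have "\<dots> = e \<otimes> x \<otimes> e"
        using M_closed[OF e] x by (simp add: m_assoc M_total[OF e])
      finally show ?thesis
        using right_semicentral_mult[OF semicentral[OF e] x] by simp
    qed
    then have "(\<Oplus>e\<in>M. e \<otimes> (x \<otimes> total)) = (\<Oplus>e\<in>M. e \<otimes> x)"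
      using M_closed x by (intro finsum_cong') auto
    then have "total \<otimes> (x \<otimes> total) = total \<otimes> x"
      using x by (simp add: total_mult)
    then show ?thesis
      using x by (simp add: m_assoc)
  qed
  then show ?thesis
    by (simp add: right_semicentral_def)
qed

abbreviation quotient_product where
  "quotient_product \<equiv> product_ring M (\<lambda>e. R Quot right_principal R (\<one> \<ominus> e))"

abbreviation quotient_map where
  "quotient_map r \<equiv> (\<lambda>e\<in>M. right_principal R (\<one> \<ominus> e) +> r)"

lemma quotient_hom:
  "e \<in> M \<Longrightarrow> ring_hom_ring R (R Quot right_principal R (\<one> \<ominus> e)) ((+>) (right_principal R (\<one> \<ominus> e)))"
  by (intro ideal.rcos_ring_hom_ring ideal_right_principal semicentral)

lemma quotient_map_eq_zero_iff:
  assumes x: "x \<in> carrier R"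
  shows "quotient_map x = \<zero>\<^bsub>quotient_product\<^esub> \<longleftrightarrow> total \<otimes> x = \<zero>"
proof -
  have "quotient_map x = \<zero>\<^bsub>quotient_product\<^esub> \<longleftrightarrow>
      (\<forall>e\<in>M. right_principal R (\<one> \<ominus> e) +> x = \<zero>\<^bsub>R Quot right_principal R (\<one> \<ominus> e)\<^esub>)"
    unfolding product_ring_simps by (auto simp: fun_eq_iff restrict_def)
  also have "\<dots> \<longleftrightarrow> total \<otimes> x = \<zero>"
    using right_principal_coset_zero_iff[OF semicentral x] total_annihilates_iff[OF x] by simp
  finally show ?thesis .
qed

text \<open>Here \<open>total\<close> serves as \<open>w\<close>: since \<open>e total = e\<close>,
  it becomes the identity in every factor, and its annihilator is exactly the kernel.\<close>

lemma unit_preimage_quotient_map: "unit_preimage R quotient_product quotient_map total"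
proof -
  let ?K = "\<lambda>e. right_principal R (\<one> \<ominus> e)"
  have ringP: "ring quotient_product"
    by (rule ring_product_ring) (rule ideal.quotient_is_ring[OF ideal_right_principal[OF semicentral]])
  have "quotient_map \<in> ring_hom R quotient_product"
  proof (rule ring_hom_memI)
    note q = quotient_hom[THEN ring_hom_ring.homh]
    show "quotient_map x \<in> carrier quotient_product" if "x \<in> carrier R" for x
      unfolding restrict_mem_product_ring using that ring_hom_closed[OF q] by blast
    show "quotient_map \<one> = \<one>\<^bsub>quotient_product\<^esub>"
      unfolding product_ring_simps by (rule restrict_ext) (rule ring_hom_one[OF q])
    fix x y assume xy: "x \<in> carrier R" "y \<in> carrier R"
    show "quotient_map (x \<otimes> y) = quotient_map x \<otimes>\<^bsub>quotient_product\<^esub> quotient_map y"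
      unfolding product_ring_simps by (rule restrict_ext) (simp add: ring_hom_mult[OF q xy])
    show "quotient_map (x \<oplus> y) = quotient_map x \<oplus>\<^bsub>quotient_product\<^esub> quotient_map y"
      unfolding product_ring_simps by (rule restrict_ext) (simp add: ring_hom_add[OF q xy])
  qed
  then interpret p: ring_hom_ring R quotient_product quotient_map
    using ring_axioms ringP by (intro ring_hom_ringI2)
  have surj: "\<exists>r\<in>carrier R. quotient_map r = y" if y: "y \<in> carrier quotient_product" for y
  proof -
    have "\<forall>e\<in>M. \<exists>r\<in>carrier R. y e = ?K e +> r"
      using y by (auto simp: product_ring_simps FactRing_def A_RCOSETS_def' dest!: PiE_mem)
    then obtain r where r: "\<And>e. e \<in> M \<Longrightarrow> r e \<in> carrier R" "\<And>e. e \<in> M \<Longrightarrow> y e = ?K e +> r e"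
      by metis
    \<comment> \<open>The explicit Chinese remainder solution, whose product with each
      \<open>e\<close> is \<open>e \<otimes> r e\<close>.\<close>
    let ?r = "\<Oplus>f\<in>M. f \<otimes> r f"
    have rR: "?r \<in> carrier R"
      using r(1) M_closed by (intro finsum_closed) auto
    have "?K e +> ?r = y e" if e: "e \<in> M" for e
      using M_finsum[OF e r(1)] right_principal_coset_eq_iff[OF semicentral[OF e] rR r(1)[OF e]] r(2)[OF e]
      by simp
    then have "quotient_map ?r = y"
      by (rule restrict_eq_product_ring[OF y])
    with rR show ?thesis
      by blast
  qed
  show ?thesis
  proof unfold_locales
    show "quotient_map ` carrier R = carrier quotient_product"
      using surj p.hom_closed by blast
    have "total \<otimes> \<one> \<noteq> \<zero>"
      using total_annihilates_iff[OF one_closed] M_nonempty not_zero M_closed by fastforce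
    then show "\<one>\<^bsub>quotient_product\<^esub> \<noteq> \<zero>\<^bsub>quotient_product\<^esub>"
      using quotient_map_eq_zero_iff[OF one_closed] p.hom_one by simp
    have "?K e +> total = ?K e +> \<one>" if "e \<in> M" for e
      using right_principal_coset_eq_iff[OF semicentral[OF that] total_closed one_closed]
        M_total[OF that] M_closed[OF that] by simp
    then have "quotient_map total = quotient_map \<one>"
      by (rule restrict_ext)
    then show "quotient_map total \<in> Units quotient_product"
      using p.hom_one p.S.Units_one_closed by simp
  qed (use quotient_map_eq_zero_iff in auto)
qed

lemma quotient_map_denominators:
  "unit_preimage.denominators R quotient_product quotient_map = (\<Inter>e\<in>M. quotient_units e)"
proof -
  interpret p: unit_preimage R quotient_product quotient_map total
    by (rule unit_preimage_quotient_map)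
  show ?thesis
    using M_nonempty unfolding p.denominators_def Units_product_ring quotient_units_def
    by (auto dest: p.hom_closed simp del: p.hom_closed)
qed

end

section \<open>Lifted idempotents and maximal left denominator sets\<close>

text \<open>The isomorphism of \<open>R/rad(R)\<close> with the product enters through its
  coordinates: \<open>\<phi> i\<close> is the coset map, followed by the isomorphism and the
  \<open>i\<close>-th projection. The assumption \<open>kernel\<close> records injectivity.\<close>

locale lifted_decomposition = left_artinian_ring R for R :: "('a, 'm) ring_scheme" (structure) +
  fixes s :: nat
    and Rbar :: "nat \<Rightarrow> ('b, 'n) ring_scheme"
    and \<phi> :: "nat \<Rightarrow> 'a \<Rightarrow> 'b"
    and \<epsilon> :: "nat \<Rightarrow> 'a"
  assumes simple_Rbar: "i \<in> {1..s} \<Longrightarrow> simple_artinian_ring (Rbar i)"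
    and hom: "i \<in> {1..s} \<Longrightarrow> \<phi> i \<in> ring_hom R (Rbar i)"
    and surj: "i \<in> {1..s} \<Longrightarrow> \<phi> i ` carrier R = carrier (Rbar i)"
    and kernel: "\<lbrakk>r \<in> carrier R; \<And>i. i \<in> {1..s} \<Longrightarrow> \<phi> i r = \<zero>\<^bsub>Rbar i\<^esub>\<rbrakk> \<Longrightarrow> r \<in> jacobson_radical R"
    and lift_closed: "i \<in> {1..s} \<Longrightarrow> \<epsilon> i \<in> carrier R"
    and lift_orthogonal:
      "\<lbrakk>i \<in> {1..s}; j \<in> {1..s}\<rbrakk> \<Longrightarrow> \<epsilon> i \<otimes> \<epsilon> j = (if i = j then \<epsilon> i else \<zero>)"
    and lift_sum: "(\<Oplus>i\<in>{1..s}. \<epsilon> i) = \<one>"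
    and hom_lift:
      "\<lbrakk>i \<in> {1..s}; j \<in> {1..s}\<rbrakk> \<Longrightarrow> \<phi> j (\<epsilon> i) = (if j = i then \<one>\<^bsub>Rbar j\<^esub> else \<zero>\<^bsub>Rbar j\<^esub>)"
begin

abbreviation E where "E \<equiv> idem_sum R \<epsilon>"

lemma hom_ring: "i \<in> {1..s} \<Longrightarrow> ring_hom_ring R (Rbar i) (\<phi> i)"
  using simple_Rbar[of i] hom[of i] ring_axioms
  by (intro ring_hom_ringI2) (auto simp: simple_artinian_ring_def left_artinian_ring_def)

lemma E_closed: "I \<subseteq> {1..s} \<Longrightarrow> E I \<in> carrier R"
  unfolding idem_sum_def using lift_closed by (intro finsum_closed) blast

lemma E_empty: "E {} = \<zero>"
  by (simp add: idem_sum_def)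

lemma E_insert:
  assumes "insert i I \<subseteq> {1..s}" "i \<notin> I"
  shows "E (insert i I) = \<epsilon> i \<oplus> E I"
proof -
  have "finite I"
    using assms(1) finite_subset by auto
  then show ?thesis
    unfolding idem_sum_def using assms lift_closed by (intro finsum_insert) auto
qed

lemma E_full: "E {1..s} = \<one>"
  unfolding idem_sum_def by (rule lift_sum)

lemma subset_induct [consumes 1, case_names empty insert]:
  assumes "I \<subseteq> {1..s}" "P {}"
    and "\<And>i I. \<lbrakk>insert i I \<subseteq> {1..s}; i \<notin> I; P I\<rbrakk> \<Longrightarrow> P (insert i I)"
  shows "P I"
proof -
  have "finite I"
    using assms(1) finite_subset by auto
  then show ?thesis
    using assms by (induction I rule: finite_induct) auto
qed

lemma lift_mult_E:
  assumes i: "i \<in> {1..s}" and J: "J \<subseteq> {1..s}"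
  shows "\<epsilon> i \<otimes> E J = (if i \<in> J then \<epsilon> i else \<zero>)"
  using J
proof (induction J rule: subset_induct)
  case empty
  then show ?case
    using lift_closed[OF i] by (simp add: E_empty)
next
  case (insert j J)
  have j: "j \<in> {1..s}" "J \<subseteq> {1..s}"
    using insert.hyps by auto
  have "\<epsilon> i \<otimes> E (insert j J) = \<epsilon> i \<otimes> \<epsilon> j \<oplus> \<epsilon> i \<otimes> E J"
    using lift_closed[OF i] lift_closed[OF j(1)] E_closed[OF j(2)]
    by (simp only: E_insert[OF insert.hyps] r_distr)
  also have "\<dots> = (if i = j then \<epsilon> i else \<zero>) \<oplus> (if i \<in> J then \<epsilon> i else \<zero>)"
    by (simp only: lift_orthogonal[OF i j(1)] insert.IH)
  finally show ?case
    using lift_closed[OF i] insert.hyps(2) by auto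
qed

lemma E_mult:
  assumes I: "I \<subseteq> {1..s}" and J: "J \<subseteq> {1..s}"
  shows "E I \<otimes> E J = E (I \<inter> J)"
  using I
proof (induction I rule: subset_induct)
  case empty
  then show ?case
    using E_closed[OF J] by (simp add: E_empty)
next
  case (insert i I)
  have i: "i \<in> {1..s}" "I \<subseteq> {1..s}"
    using insert.hyps by auto
  have "E (insert i I) \<otimes> E J = \<epsilon> i \<otimes> E J \<oplus> E I \<otimes> E J"
    using lift_closed[OF i(1)] E_closed[OF i(2)] E_closed[OF J]
    by (simp only: E_insert[OF insert.hyps] l_distr)
  also have "\<dots> = (if i \<in> J then \<epsilon> i else \<zero>) \<oplus> E (I \<inter> J)"
    by (simp only: lift_mult_E[OF i(1) J] insert.IH)
  also have "\<dots> = E (insert i I \<inter> J)"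
  proof (cases "i \<in> J")
    case True
    then have "E (insert i I \<inter> J) = \<epsilon> i \<oplus> E (I \<inter> J)"
      using E_insert[of i "I \<inter> J"] insert.hyps by auto
    with True show ?thesis
      by simp
  next
    case False
    then have "insert i I \<inter> J = I \<inter> J"
      by auto
    moreover have "E (I \<inter> J) \<in> carrier R"
      using i(2) by (intro E_closed) auto
    ultimately show ?thesis
      using False by simp
  qed
  finally show ?case .
qed

lemma hom_E:
  assumes j: "j \<in> {1..s}" and I: "I \<subseteq> {1..s}"
  shows "\<phi> j (E I) = (if j \<in> I then \<one>\<^bsub>Rbar j\<^esub> else \<zero>\<^bsub>Rbar j\<^esub>)"
  using I
proof (induction I rule: subset_induct)
  interpret h: ring_hom_ring R "Rbar j" "\<phi> j"
    by (rule hom_ring[OF j])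
  {
    case empty
    then show ?case
      by (simp add: E_empty)
  next
    case (insert i I)
    have i: "i \<in> {1..s}" "I \<subseteq> {1..s}"
      using insert.hyps by auto
    have "\<phi> j (E (insert i I)) = \<phi> j (\<epsilon> i) \<oplus>\<^bsub>Rbar j\<^esub> \<phi> j (E I)"
      using lift_closed[OF i(1)] E_closed[OF i(2)] by (simp add: E_insert[OF insert.hyps])
    also have "\<phi> j (\<epsilon> i) = (if i = j then \<one>\<^bsub>Rbar j\<^esub> else \<zero>\<^bsub>Rbar j\<^esub>)"
      using hom_lift[OF i(1) j] by auto
    also note insert.IH
    finally show ?case
      using insert.hyps(2) by (cases "i = j") auto
  }
qed

lemma Rbar_one_not_zero: "j \<in> {1..s} \<Longrightarrow> \<one>\<^bsub>Rbar j\<^esub> \<noteq> \<zero>\<^bsub>Rbar j\<^esub>"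
  using simple_Rbar left_artinian_ring.one_not_zero unfolding simple_artinian_ring_def by blast

text \<open>\<open>\<phi> j\<close> sends \<open>E I\<close> to the identity or to zero according to
  whether \<open>j \<in> I\<close>, and these two differ in \<open>Rbar j\<close>; so
  \<open>I\<close> can be read off from its idempotent.\<close>

lemma inj_on_E: "inj_on E (Pow {1..s})"
proof (rule inj_onI)
  fix I J assume IJ: "I \<in> Pow {1..s}" "J \<in> Pow {1..s}" "E I = E J"
  have "j \<in> I \<longleftrightarrow> j \<in> J" if j: "j \<in> {1..s}" for j
    using hom_E[OF j, of I] hom_E[OF j, of J] IJ Rbar_one_not_zero[OF j]
    by (auto split: if_splits)
  then show "I = J"
    using IJ by blast
qed

text \<open>Index sets replace idempotents: as \<open>E\<close> is injective,
  \<open>admissible\<close> and \<open>minimal\<close> sets ordered by inclusion stand for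
  \<open>I'_l\<close> and its minimal elements.\<close>

definition admissible where
  "admissible I \<longleftrightarrow> I \<subseteq> {1..s} \<and> I \<noteq> {} \<and> right_semicentral R (E I)"

definition minimal where
  "minimal I \<longleftrightarrow> admissible I \<and> (\<forall>J. admissible J \<longrightarrow> J \<subseteq> I \<longrightarrow> J = I)"

lemma minimal_admissible: "minimal I \<Longrightarrow> admissible I"
  by (simp add: minimal_def)

lemma admissibleD:
  assumes "admissible I"
  shows "I \<subseteq> {1..s}" "I \<noteq> {}" "right_semicentral R (E I)"
  using assms by (auto simp: admissible_def)

lemma I'_l_eq: "I'_l R s \<epsilon> = E ` Collect admissible"
proof -
  have "(\<forall>r\<in>carrier R. E I \<otimes> r \<otimes> (\<one> \<ominus> E I) = \<zero>) \<longleftrightarrow> right_semicentral R (E I)"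
    if "I \<subseteq> {1..s}" for I
  proof -
    note [simp] = E_closed[OF that]
    have "E I \<otimes> r \<otimes> (\<one> \<ominus> E I) = \<zero> \<longleftrightarrow> E I \<otimes> r \<otimes> E I = E I \<otimes> r" if [simp]: "r \<in> carrier R" for r
    proof -
      have "E I \<otimes> r \<otimes> (\<one> \<ominus> E I) = E I \<otimes> r \<ominus> E I \<otimes> r \<otimes> E I"
        by (simp add: minus_eq r_distr r_minus)
      then show ?thesis
        using r_right_minus_eq[of "E I \<otimes> r" "E I \<otimes> r \<otimes> E I"] by auto
    qed
    then show ?thesis
      by (simp add: right_semicentral_def)
  qed
  then show ?thesis
    unfolding I'_l_def image_def admissible_def by blast
qed

text \<open>\<open>idem_le\<close> only asserts that some nested index sets represent the two
  idempotents; by injectivity of \<open>E\<close> they are the given ones.\<close>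

lemma min_I'_l_eq: "min_I'_l R s \<epsilon> = E ` Collect minimal"
proof -
  have le: "idem_le R s \<epsilon> (E J) (E I) \<longleftrightarrow> J \<subseteq> I" if I: "admissible I" and J: "admissible J" for I J
  proof
    assume "idem_le R s \<epsilon> (E J) (E I)"
    then obtain J' I' where *: "J' \<subseteq> I'" "I' \<subseteq> {1..s}" "E J = E J'" "E I = E I'"
      unfolding idem_le_def by blast
    then have "J = J'" "I = I'"
      using *(1,2) admissibleD(1)[OF I] admissibleD(1)[OF J]
      by (intro inj_onD[OF inj_on_E *(3)] inj_onD[OF inj_on_E *(4)]; blast)+
    with * show "J \<subseteq> I"
      by simp
  next
    assume "J \<subseteq> I"
    then show "idem_le R s \<epsilon> (E J) (E I)"
      unfolding idem_le_def using admissibleD(1)[OF I] admissibleD(2)[OF J] by blast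
  qed
  have eq: "E J = E I \<longleftrightarrow> J = I" if "admissible I" "admissible J" for I J
    using inj_on_eq_iff[OF inj_on_E] admissibleD(1) that by blast
  show ?thesis
    unfolding min_I'_l_def I'_l_eq minimal_def using le eq by auto
qed

lemma finite_admissible: "finite (Collect admissible)"
  by (rule finite_subset[of _ "Pow {1..s}"]) (use admissibleD(1) in blast, simp)

lemma minimal_below:
  assumes "admissible I"
  obtains J where "minimal J" "J \<subseteq> I"
proof -
  let ?F = "{J. admissible J \<and> J \<subseteq> I}"
  have "finite ?F" "?F \<noteq> {}"
    using assms by (auto intro: finite_subset[OF _ finite_admissible])
  then obtain J where J: "J \<in> ?F" and min: "\<forall>K\<in>?F. K \<subseteq> J \<longrightarrow> J = K"
    using finite_has_minimal[of ?F] by auto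
  have "K = J" if "admissible K" "K \<subseteq> J" for K
    using J min that by auto
  then have "minimal J"
    using J by (simp add: minimal_def)
  then show ?thesis
    using that[of J] J by simp
qed

text \<open>If \<open>s\<close> were zero, the empty sum would equal \<open>\<one>\<close>. This set
  is the starting point for the existence of a minimal one.\<close>

lemma admissible_full: "admissible {1..s}"
proof -
  have "s \<noteq> 0"
    using E_full E_empty one_not_zero by (metis atLeastatMost_empty less_one)
  then show ?thesis
    unfolding admissible_def E_full by (simp add: right_semicentral_def)
qed

text \<open>The factors are absorbed in turn: right semicentrality of \<open>E I\<close> removes the
  second \<open>E I\<close>, then that of \<open>E J\<close> removes the last \<open>E J\<close>.
  Closure under intersection is what makes distinct minimal sets disjoint.\<close>

lemma admissible_Int:
  assumes I: "admissible I" and J: "admissible J" and ne: "I \<inter> J \<noteq> {}"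
  shows "admissible (I \<inter> J)"
proof -
  note IE = admissibleD[OF I] and JE = admissibleD[OF J]
  note [simp] = E_closed[OF IE(1)] E_closed[OF JE(1)]
  have IJ: "E (I \<inter> J) = E I \<otimes> E J" and JI: "E (I \<inter> J) = E J \<otimes> E I"
    using E_mult IE(1) JE(1) by (metis, metis inf_commute)
  have "(E I \<otimes> E J) \<otimes> x \<otimes> (E I \<otimes> E J) = (E I \<otimes> E J) \<otimes> x" if x: "x \<in> carrier R" for x
  proof -
    have "(E I \<otimes> E J) \<otimes> x \<otimes> (E I \<otimes> E J) = (E I \<otimes> (E J \<otimes> x) \<otimes> E I) \<otimes> E J"
      using x by (simp add: m_assoc)
    also have "\<dots> = E I \<otimes> (E J \<otimes> x \<otimes> E J)"
      using x right_semicentral_mult[OF IE(3), of "E J \<otimes> x"] by (simp add: m_assoc)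
    also have "\<dots> = E I \<otimes> E J \<otimes> x"
      using x right_semicentral_mult[OF JE(3), of x] by (simp add: m_assoc)
    finally show ?thesis .
  qed
  then have "right_semicentral R (E (I \<inter> J))"
    unfolding IJ right_semicentral_def by simp
  then show ?thesis
    using IE(1) ne by (auto simp: admissible_def)
qed

lemma minimal_disjoint:
  assumes "minimal I" "minimal J" "I \<noteq> J"
  shows "I \<inter> J = {}"
proof (rule ccontr)
  assume "I \<inter> J \<noteq> {}"
  then have "admissible (I \<inter> J)"
    using admissible_Int assms(1,2) minimal_admissible by blast
  then have "I \<inter> J = I" "I \<inter> J = J"
    using assms(1,2) unfolding minimal_def by blast+
  with assms(3) show False
    by blast
qed

text \<open>Modulo the radical, \<open>f\<close> becomes a central idempotent and hence agrees with some \<open>E I\<close>;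
  idempotents that agree modulo the radical are conjugate by the unit \<open>u\<close> below.\<close>

lemma right_semicentral_lift:
  assumes f: "right_semicentral R f" and f0: "f \<noteq> \<zero>"
  obtains I where "admissible I" "\<And>r. r \<in> carrier R \<Longrightarrow> E I \<otimes> r = \<zero> \<longleftrightarrow> f \<otimes> r = \<zero>"
proof -
  note fR [simp] = right_semicentral_closed[OF f]
  note ff = right_semicentral_idem[OF f]
  \<comment> \<open>Each \<open>\<phi> i f\<close> is right semicentral in a simple ring, hence zero
    or the identity; \<open>I\<close> collects the places of the second kind.\<close>
  define I where "I = {i \<in> {1..s}. \<phi> i f = \<one>\<^bsub>Rbar i\<^esub>}"
  define e where "e = E I"
  have Is: "I \<subseteq> {1..s}"
    by (auto simp: I_def)
  have eR [simp]: "e \<in> carrier R"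
    unfolding e_def by (rule E_closed[OF Is])
  have ee: "e \<otimes> e = e"
    unfolding e_def using E_mult[OF Is Is] by simp
  \<comment> \<open>The usual intertwiner of two idempotents, with \<open>f u = f e = u e\<close>.
    It reduces to the identity modulo the radical because \<open>f\<close> and \<open>e\<close> have
    equal images under every \<open>\<phi> i\<close>.\<close>
  define u where "u = f \<otimes> e \<oplus> (\<one> \<ominus> f) \<otimes> (\<one> \<ominus> e)"
  have uR [simp]: "u \<in> carrier R"
    by (simp add: u_def)
  have hom_u: "\<phi> i (u \<ominus> \<one>) = \<zero>\<^bsub>Rbar i\<^esub>" if i: "i \<in> {1..s}" for i
  proof -
    interpret h: ring_hom_ring R "Rbar i" "\<phi> i"
      by (rule hom_ring[OF i])
    interpret S: simple_artinian_ring "Rbar i"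
      by (rule simple_Rbar[OF i])
    have "\<phi> i f \<otimes>\<^bsub>Rbar i\<^esub> y \<otimes>\<^bsub>Rbar i\<^esub> \<phi> i f = \<phi> i f \<otimes>\<^bsub>Rbar i\<^esub> y" if y: "y \<in> carrier (Rbar i)" for y
    proof -
      obtain x where x: "x \<in> carrier R" "y = \<phi> i x"
        using y surj[OF i] by blast
      have "\<phi> i (f \<otimes> x \<otimes> f) = \<phi> i (f \<otimes> x)"
        using right_semicentral_mult[OF f x(1)] by simp
      then show ?thesis
        using x by simp
    qed
    then have "\<phi> i f = \<zero>\<^bsub>Rbar i\<^esub> \<or> \<phi> i f = \<one>\<^bsub>Rbar i\<^esub>"
      by (intro S.right_semicentral_trivial) auto
    moreover have "\<phi> i e = (if i \<in> I then \<one>\<^bsub>Rbar i\<^esub> else \<zero>\<^bsub>Rbar i\<^esub>)"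
      unfolding e_def by (rule hom_E[OF i Is])
    moreover have "i \<in> I \<longleftrightarrow> \<phi> i f = \<one>\<^bsub>Rbar i\<^esub>"
      using i by (simp add: I_def)
    ultimately have "\<phi> i f = \<zero>\<^bsub>Rbar i\<^esub> \<and> \<phi> i e = \<zero>\<^bsub>Rbar i\<^esub> \<or>
        \<phi> i f = \<one>\<^bsub>Rbar i\<^esub> \<and> \<phi> i e = \<one>\<^bsub>Rbar i\<^esub>"
      by auto
    then show ?thesis
      by (elim disjE conjE) (simp_all add: u_def minus_eq h.S.r_neg)
  qed
  have "u \<ominus> \<one> \<in> jacobson_radical R"
    using hom_u by (intro kernel) auto
  then have "\<one> \<oplus> (u \<ominus> \<one>) \<in> Units R"
    by (rule one_plus_radical_Units)
  moreover have "\<one> \<oplus> (u \<ominus> \<one>) = u"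
    by (simp add: minus_eq a_ac r_neg)
  ultimately have "u \<in> Units R"
    by simp
  then obtain v where v [simp]: "v \<in> carrier R" and vu: "v \<otimes> u = \<one>"
    unfolding Units_def by blast
  have "f \<otimes> u = f \<otimes> f \<otimes> e \<oplus> (f \<otimes> (\<one> \<ominus> f)) \<otimes> (\<one> \<ominus> e)"
    by (simp add: u_def r_distr m_assoc)
  also have "f \<otimes> (\<one> \<ominus> f) = \<zero>"
    by (simp add: minus_eq r_distr r_minus ff r_neg)
  finally have fu: "f \<otimes> u = f \<otimes> e"
    by (simp add: ff)
  have "u \<otimes> e = f \<otimes> (e \<otimes> e) \<oplus> (\<one> \<ominus> f) \<otimes> ((\<one> \<ominus> e) \<otimes> e)"
    by (simp add: u_def l_distr m_assoc)
  also have "(\<one> \<ominus> e) \<otimes> e = \<zero>"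
    by (simp add: minus_eq l_distr l_minus ee r_neg)
  finally have ue: "u \<otimes> e = f \<otimes> e"
    by (simp add: ee)
  \<comment> \<open>This makes the annihilator of \<open>f\<close> stable under left multiplication.
    Hence conjugation by \<open>u\<close>, which a priori only translates that annihilator, leaves
    it unchanged.\<close>
  have insert_f: "f \<otimes> (x \<otimes> r) = f \<otimes> x \<otimes> (f \<otimes> r)" if "x \<in> carrier R" "r \<in> carrier R" for x r
  proof -
    have "f \<otimes> x \<otimes> (f \<otimes> r) = (f \<otimes> x \<otimes> f) \<otimes> r"
      using that by (simp add: m_assoc)
    then show ?thesis
      using that right_semicentral_mult[OF f that(1)] by (simp add: m_assoc)
  qed
  have ker: "e \<otimes> r = \<zero> \<longleftrightarrow> f \<otimes> r = \<zero>" if r: "r \<in> carrier R" for r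
  proof
    assume er: "e \<otimes> r = \<zero>"
    have "f \<otimes> (u \<otimes> r) = f \<otimes> (e \<otimes> r)"
      using r fu by (simp add: m_assoc[symmetric])
    also have "\<dots> = \<zero>"
      unfolding er by simp
    finally have fur: "f \<otimes> (u \<otimes> r) = \<zero>" .
    have "f \<otimes> r = f \<otimes> (v \<otimes> (u \<otimes> r))"
      using r vu by (simp add: m_assoc[symmetric])
    also have "\<dots> = f \<otimes> v \<otimes> (f \<otimes> (u \<otimes> r))"
      using r by (intro insert_f) auto
    also have "\<dots> = \<zero>"
      unfolding fur by simp
    finally show "f \<otimes> r = \<zero>" .
  next
    assume fr: "f \<otimes> r = \<zero>"
    have "e \<otimes> r = v \<otimes> (u \<otimes> e) \<otimes> r"
      using r vu by (simp add: m_assoc[symmetric])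
    also have "\<dots> = v \<otimes> (f \<otimes> (u \<otimes> r))"
      unfolding ue fu[symmetric] using r by (simp add: m_assoc)
    also have "\<dots> = v \<otimes> (f \<otimes> u \<otimes> (f \<otimes> r))"
      using r by (simp only: insert_f uR)
    also have "\<dots> = \<zero>"
      unfolding fr by simp
    finally show "e \<otimes> r = \<zero>" .
  qed
  have "e \<otimes> x \<otimes> e = e \<otimes> x" if x: "x \<in> carrier R" for x
  proof -
    \<comment> \<open>\<open>1 - e\<close> is killed by \<open>e\<close>, hence by \<open>f\<close>;
      then \<open>x(1 - e)\<close> is killed by \<open>f\<close>, hence by \<open>e\<close>. So
      \<open>e\<close> inherits right semicentrality from \<open>f\<close>.\<close>
    have "e \<otimes> (\<one> \<ominus> e) = \<zero>"
      by (simp add: minus_eq r_distr r_minus ee r_neg)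
    then have fe: "f \<otimes> (\<one> \<ominus> e) = \<zero>"
      using ker by simp
    have "f \<otimes> (x \<otimes> (\<one> \<ominus> e)) = \<zero>"
      using x insert_f[of x "\<one> \<ominus> e"] fe by simp
    then have "e \<otimes> (x \<otimes> (\<one> \<ominus> e)) = \<zero>"
      using x ker by simp
    moreover have "e \<otimes> (x \<otimes> (\<one> \<ominus> e)) = e \<otimes> x \<ominus> e \<otimes> x \<otimes> e"
      using x by (simp add: minus_eq r_distr r_minus m_assoc)
    ultimately show ?thesis
      using x r_right_minus_eq[of "e \<otimes> x" "e \<otimes> x \<otimes> e"] by simp
  qed
  then have "right_semicentral R e"
    by (simp add: right_semicentral_def)
  moreover have "I \<noteq> {}"
  proof
    assume "I = {}"
    then have "e \<otimes> \<one> = \<zero>"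
      by (simp add: e_def E_empty)
    then have "f \<otimes> \<one> = \<zero>"
      using ker by blast
    with f0 show False
      by simp
  qed
  ultimately have "admissible I"
    using Is by (simp add: admissible_def e_def)
  then show ?thesis
    using that ker unfolding e_def by blast
qed

text \<open>Passing from \<open>f\<close> to \<open>E J\<close> keeps the annihilator, and passing
  to a minimal \<open>I \<subseteq> J\<close> can only enlarge it, since
  \<open>E I = E I E J\<close>. The relations \<open>f x t = f = f t x\<close> therefore survive
  with \<open>E I\<close> in place of \<open>f\<close>.\<close>

lemma Den_l_coset_Units:
  assumes D: "D \<in> Den_l R"
  obtains I where "minimal I"
    "\<And>t. t \<in> D \<Longrightarrow> right_principal R (\<one> \<ominus> E I) +> t \<in> Units (R Quot right_principal R (\<one> \<ominus> E I))"
proof -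
  obtain f where f: "f \<in> carrier R" "f \<noteq> \<zero>"
    "\<And>x. x \<in> carrier R \<Longrightarrow> f \<otimes> x \<otimes> f = f \<otimes> x"
    and inv: "\<And>t. t \<in> D \<Longrightarrow> \<exists>x\<in>carrier R. f \<otimes> (x \<otimes> t) = f \<and> f \<otimes> (t \<otimes> x) = f"
    using Den_l_idempotent[OF D] by metis
  have "right_semicentral R f"
    using f by (simp add: right_semicentral_def)
  then obtain J where J: "admissible J" "\<And>r. r \<in> carrier R \<Longrightarrow> E J \<otimes> r = \<zero> \<longleftrightarrow> f \<otimes> r = \<zero>"
    using f(2) right_semicentral_lift by metis
  obtain I where I: "minimal I" "I \<subseteq> J"
    using J(1) by (rule minimal_below)
  note IE = admissibleD[OF minimal_admissible[OF I(1)]] and JE = admissibleD[OF J(1)]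
  note [simp] = E_closed[OF IE(1)] E_closed[OF JE(1)]
  have IJ: "E I \<otimes> E J = E I"
    using E_mult[OF IE(1) JE(1)] I(2) by (simp add: Int_absorb2)
  have eq: "E I \<otimes> y = E I" if y: "y \<in> carrier R" "f \<otimes> y = f" for y
  proof -
    have "f \<otimes> (y \<ominus> \<one>) = \<zero>"
      using y f(1) by (simp add: minus_eq r_distr r_minus r_neg)
    then have Jy: "E J \<otimes> (y \<ominus> \<one>) = \<zero>"
      using J(2) y(1) by simp
    have "E I \<otimes> (y \<ominus> \<one>) = E I \<otimes> E J \<otimes> (y \<ominus> \<one>)"
      by (simp only: IJ)
    also have "\<dots> = E I \<otimes> (E J \<otimes> (y \<ominus> \<one>))"
      using y(1) by (simp add: m_assoc)
    also have "\<dots> = \<zero>"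
      unfolding Jy by simp
    finally show ?thesis
      using y(1) r_right_minus_eq[of "E I \<otimes> y" "E I"] by (simp add: minus_eq r_distr r_minus)
  qed
  show ?thesis
  proof (rule that[OF I(1)])
    fix t assume t: "t \<in> D"
    have tR: "t \<in> carrier R"
      using D t submonoid.subset
      by (auto simp: Den_l_def left_Ore_set_def multiplicative_subset_def)
    obtain x where "x \<in> carrier R" "f \<otimes> (x \<otimes> t) = f" "f \<otimes> (t \<otimes> x) = f"
      using inv[OF t] by blast
    then show "right_principal R (\<one> \<ominus> E I) +> t \<in> Units (R Quot right_principal R (\<one> \<ominus> E I))"
      using tR eq IE(3) by (intro right_principal_coset_Units[of _ _ x]) auto
  qed
qed

end

section \<open>The maximal left denominator sets and their intersection\<close>

context lifted_decomposition
begin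

lemma mem_min_I'_l:
  assumes "e \<in> min_I'_l R s \<epsilon>"
  obtains I where "minimal I" "e = E I" "I \<subseteq> {1..s}" "right_semicentral R e"
  using assms that admissibleD(1,3)[OF minimal_admissible] unfolding min_I'_l_eq by blast

lemma E_eq_zero: "\<lbrakk>I \<subseteq> {1..s}; E I = \<zero>\<rbrakk> \<Longrightarrow> I = {}"
  using inj_onD[OF inj_on_E, of I "{}"] by (simp add: E_empty)

sublocale min: orthogonal_right_semicentral R "min_I'_l R s \<epsilon>"
proof unfold_locales
  show "finite (min_I'_l R s \<epsilon>)"
    unfolding min_I'_l_eq
    by (rule finite_imageI, rule finite_subset[OF _ finite_admissible]) (use minimal_admissible in blast)
  show "min_I'_l R s \<epsilon> \<noteq> {}"
    using minimal_below[OF admissible_full] unfolding min_I'_l_eq by blast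
next
  fix e assume "e \<in> min_I'_l R s \<epsilon>"
  then obtain I where I: "minimal I" "e = E I" "I \<subseteq> {1..s}" "right_semicentral R e"
    by (rule mem_min_I'_l)
  show "right_semicentral R e"
    by (rule I(4))
  show "e \<noteq> \<zero>"
    using E_eq_zero[OF I(3)] I(2) admissibleD(2)[OF minimal_admissible[OF I(1)]] by auto
next
  fix e f assume "e \<in> min_I'_l R s \<epsilon>" "f \<in> min_I'_l R s \<epsilon>" and ne: "e \<noteq> f"
  then obtain I J where I: "minimal I" "e = E I" "I \<subseteq> {1..s}" and J: "minimal J" "f = E J" "J \<subseteq> {1..s}"
    by (metis mem_min_I'_l)
  then have "I \<inter> J = {}"
    using minimal_disjoint[OF I(1) J(1)] ne by blast
  then show "e \<otimes> f = \<zero>"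
    using E_mult[OF I(3) J(3)] I(2) J(2) by (simp add: E_empty)
qed

text \<open>\<open>e\<close> belongs to its own set, so the inclusion would make it an idempotent
  unit modulo \<open>(1 - f)R\<close> and give \<open>f e = f\<close>; for distinct members this
  contradicts orthogonality and \<open>f \<noteq> 0\<close>.\<close>

lemma quotient_units_subset:
  assumes e: "e \<in> min_I'_l R s \<epsilon>" and f: "f \<in> min_I'_l R s \<epsilon>"
    and sub: "quotient_units e \<subseteq> quotient_units f"
  shows "e = f"
proof (rule ccontr)
  assume "e \<noteq> f"
  have "e \<in> quotient_units f"
    using mem_quotient_units[OF min.semicentral[OF e]] sub by blast
  then have "f \<otimes> e = f"
    using idempotent_mem_quotient_units[OF min.semicentral[OF f]]
      right_semicentral_idem[OF min.semicentral[OF e]] by blast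
  then show False
    using min.orthogonal[OF f e] min.not_zero[OF f] \<open>e \<noteq> f\<close> by simp
qed

text \<open>Three facts combine: each set \<open>quotient_units e\<close> is a left denominator set,
  every left denominator set lies in one of them, and inclusions between them are
  equalities.\<close>

lemma max_Den_l_eq: "max_Den_l R = quotient_units ` min_I'_l R s \<epsilon>"
proof -
  have Den: "quotient_units e \<in> Den_l R" if "e \<in> min_I'_l R s \<epsilon>" for e
    using quotient_units_localization(1) min.semicentral min.not_zero that by blast
  have above: "\<exists>f\<in>min_I'_l R s \<epsilon>. D \<subseteq> quotient_units f" if D: "D \<in> Den_l R" for D
  proof -
    obtain I where "minimal I" and u: "\<And>t. t \<in> D \<Longrightarrow>
        right_principal R (\<one> \<ominus> E I) +> t \<in> Units (R Quot right_principal R (\<one> \<ominus> E I))"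
      using Den_l_coset_Units[OF D] by blast
    moreover have "D \<subseteq> carrier R"
      using D submonoid.subset
      by (auto simp: Den_l_def left_Ore_set_def multiplicative_subset_def)
    ultimately show ?thesis
      unfolding min_I'_l_eq quotient_units_def by blast
  qed
  show ?thesis
  proof (intro equalityI subsetI)
    fix D assume "D \<in> max_Den_l R"
    then have D: "D \<in> Den_l R" "\<And>D'. \<lbrakk>D' \<in> Den_l R; D \<subseteq> D'\<rbrakk> \<Longrightarrow> D' = D"
      unfolding max_Den_l_def by blast+
    then show "D \<in> quotient_units ` min_I'_l R s \<epsilon>"
      using above[OF D(1)] Den by blast
  next
    fix D assume "D \<in> quotient_units ` min_I'_l R s \<epsilon>"
    then obtain e where e: "e \<in> min_I'_l R s \<epsilon>" "D = quotient_units e"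
      by blast
    have "D' = D" if D': "D' \<in> Den_l R" "D \<subseteq> D'" for D'
    proof -
      obtain f where f: "f \<in> min_I'_l R s \<epsilon>" "D' \<subseteq> quotient_units f"
        using above[OF D'(1)] by blast
      then have "e = f"
        using quotient_units_subset[OF e(1) f(1)] D'(2) e(2) by blast
      then show ?thesis
        using D'(2) e(2) f(2) by blast
    qed
    then show "D \<in> max_Den_l R"
      using Den[OF e(1)] e(2) unfolding max_Den_l_def by blast
  qed
qed

lemma inj_on_quotient_units: "inj_on quotient_units (min_I'_l R s \<epsilon>)"
  by (rule inj_onI) (rule quotient_units_subset; simp)

text \<open>The intersection is the preimage of the units of the product ring, hence itself a left
  denominator set. It is therefore the largest member of the union that defines
  \<open>T_l\<close>.\<close>

lemma T_l_eq: "T_l R = \<Inter> (max_Den_l R)"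
proof -
  interpret p: unit_preimage R min.quotient_product min.quotient_map min.total
    by (rule min.unit_preimage_quotient_map)
  have "\<Inter> (max_Den_l R) = p.denominators"
    unfolding max_Den_l_eq min.quotient_map_denominators by (rule refl)
  then have "\<Inter> (max_Den_l R) \<in> Den_l R"
    using p.denominators_Den_l by simp
  then show ?thesis
    unfolding T_l_def L_l_s_def by blast
qed

lemma T_l_localization:
  shows "ass_T_l R = right_principal R (\<one> \<ominus> min.total)"
    and "canonical_map R (T_l R) \<in> ring_iso (R Quot ass_T_l R) (Q_l_s R)"
    and "R Quot right_principal R (\<one> \<ominus> min.total) \<simeq> min.quotient_product"
proof -
  interpret p: unit_preimage R min.quotient_product min.quotient_map min.total
    by (rule min.unit_preimage_quotient_map)
  have T: "T_l R = p.denominators"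
    unfolding T_l_eq max_Den_l_eq min.quotient_map_denominators by (rule refl)
  have ker: "a_kernel R min.quotient_product min.quotient_map = right_principal R (\<one> \<ominus> min.total)"
    by (rule Set.set_eqI) (simp only: p.kernel_iff mem_right_principal_iff[OF min.right_semicentral_total]
        min.quotient_map_eq_zero_iff cong: conj_cong)
  have ass: "ass_T_l R = a_kernel R min.quotient_product min.quotient_map"
    unfolding ass_T_l_def T by (rule p.ass_denominators)
  show "ass_T_l R = right_principal R (\<one> \<ominus> min.total)"
    using ass ker by simp
  show "canonical_map R (T_l R) \<in> ring_iso (R Quot ass_T_l R) (Q_l_s R)"
    unfolding ass Q_l_s_def T by (rule p.canonical_map_iso)
  show "R Quot right_principal R (\<one> \<ominus> min.total) \<simeq> min.quotient_product"
    using p.FactRing_iso[OF p.surj] unfolding ker .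
qed

text \<open>Membership in every \<open>(1 - e)R\<close> means \<open>e x = 0\<close> for every
  minimal \<open>e\<close>, which \<open>total_annihilates_iff\<close> condenses into the single
  equation \<open>total x = 0\<close>.\<close>

lemma ass_max_eq: "ass_max R = right_principal R (\<one> \<ominus> min.total)"
proof (rule Set.set_eqI)
  fix x
  have "ass R (quotient_units e) = right_principal R (\<one> \<ominus> e)" if "e \<in> min_I'_l R s \<epsilon>" for e
    using quotient_units_localization(2)[OF min.semicentral[OF that] min.not_zero[OF that]] .
  then have "x \<in> ass_max R \<longleftrightarrow> (\<forall>e\<in>min_I'_l R s \<epsilon>. x \<in> right_principal R (\<one> \<ominus> e))"
    unfolding ass_max_def max_Den_l_eq by auto
  also have "\<dots> \<longleftrightarrow> x \<in> carrier R \<and> (\<forall>e\<in>min_I'_l R s \<epsilon>. e \<otimes> x = \<zero>)"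
    using mem_right_principal_iff[OF min.semicentral] min.M_nonempty by blast
  also have "\<dots> \<longleftrightarrow> x \<in> right_principal R (\<one> \<ominus> min.total)"
    using mem_right_principal_iff[OF min.right_semicentral_total] min.total_annihilates_iff by blast
  finally show "x \<in> ass_max R \<longleftrightarrow> x \<in> right_principal R (\<one> \<ominus> min.total)" .
qed

text \<open>\<open>quotient_units\<close> is injective on the minimal idempotents, and its inverse
  serves as the reindexing of the factors.\<close>

lemma quotient_product_iso:
  "min.quotient_product \<simeq> product_ring (max_Den_l R) (\<lambda>S. left_localization R S)"
proof -
  let ?\<sigma> = "inv_into (min_I'_l R s \<epsilon>) quotient_units"
  have bij: "bij_betw ?\<sigma> (max_Den_l R) (min_I'_l R s \<epsilon>)"
    unfolding max_Den_l_eq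
    by (rule bij_betw_inv_into) (simp add: bij_betw_def inj_on_quotient_units)
  have "\<exists>g. g \<in> ring_iso (R Quot right_principal R (\<one> \<ominus> ?\<sigma> S)) (left_localization R S)"
    if S: "S \<in> max_Den_l R" for S
  proof -
    have e: "?\<sigma> S \<in> min_I'_l R s \<epsilon>" "quotient_units (?\<sigma> S) = S"
      using S unfolding max_Den_l_eq by (rule inv_into_into, rule f_inv_into_f)
    show ?thesis
      using quotient_units_localization(3)[OF min.semicentral[OF e(1)] min.not_zero[OF e(1)]]
      unfolding e(2) .
  qed
  then obtain g where "\<And>S. S \<in> max_Den_l R \<Longrightarrow>
      g S \<in> ring_iso (R Quot right_principal R (\<one> \<ominus> ?\<sigma> S)) (left_localization R S)"
    by metis
  then show ?thesis
    by (rule product_ring_iso[OF bij])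
qed

end

section \<open>From the decomposition of \<open>R/rad(R)\<close> to coordinate maps on
  \<open>R\<close>\<close>

lemma lifted_decompositionI:
  fixes R (structure)
  assumes R: "left_artinian_ring R"
    and decomp: "semisimple_quotient_decomposition R s Rbar h"
    and lift: "lifted_idempotents R s Rbar h \<epsilon>"
  shows "lifted_decomposition R s Rbar (\<lambda>i r. h (jacobson_radical R +> r) i) \<epsilon>"
proof -
  interpret left_artinian_ring R
    by (rule R)
  let ?J = "jacobson_radical R"
  let ?P = "product_ring {1..s} Rbar"
  interpret J: ideal ?J R
    by (rule ideal_jacobson_radical)
  have simple: "simple_artinian_ring (Rbar i)" if "i \<in> {1..s}" for i
    using decomp that by (simp add: semisimple_quotient_decomposition_def)
  then have ring_Rbar: "ring (Rbar i)" if "i \<in> {1..s}" for i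
    using that by (simp add: simple_artinian_ring_def left_artinian_ring_def)
  have iso: "h \<in> ring_iso (R Quot ?J) ?P"
    using decomp by (simp add: semisimple_quotient_decomposition_def)
  then have hom: "h \<in> ring_hom (R Quot ?J) ?P"
    and bij: "bij_betw h (carrier (R Quot ?J)) (carrier ?P)"
    by (auto simp: ring_iso_def)
  have coset: "?J +> r \<in> carrier (R Quot ?J)" if "r \<in> carrier R" for r
    using ring_hom_closed[OF J.rcos_ring_hom that] .
  have h0: "h \<zero>\<^bsub>R Quot ?J\<^esub> = \<zero>\<^bsub>?P\<^esub>"
    using ring_hom_zero[OF hom J.quotient_is_ring ring_product_ring[OF ring_Rbar]] by simp
  show ?thesis
  proof (rule lifted_decomposition.intro[OF R lifted_decomposition_axioms.intro])
    fix i assume i: "i \<in> {1..s}"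
    show "simple_artinian_ring (Rbar i)"
      by (rule simple[OF i])
    show "(\<lambda>r. h (?J +> r) i) \<in> ring_hom R (Rbar i)"
      using ring_hom_trans[OF ring_hom_trans[OF J.rcos_ring_hom hom] product_ring_proj_hom[OF i]]
      by (simp add: comp_def)
    show "(\<lambda>r. h (?J +> r) i) ` carrier R = carrier (Rbar i)"
    proof (intro equalityI subsetI)
      fix y assume "y \<in> (\<lambda>r. h (?J +> r) i) ` carrier R"
      then show "y \<in> carrier (Rbar i)"
        using product_ring_mem[OF ring_hom_closed[OF hom coset] i] by blast
    next
      fix y assume y: "y \<in> carrier (Rbar i)"
      \<comment> \<open>The tuple with \<open>y\<close> in place \<open>i\<close> and zero
        elsewhere; a coset mapped to it by \<open>h\<close> supplies a preimage of
        \<open>y\<close>.\<close>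
      let ?y = "\<lambda>j\<in>{1..s}. if j = i then y else \<zero>\<^bsub>Rbar j\<^esub>"
      have "?y \<in> carrier ?P"
        unfolding restrict_mem_product_ring using y ring.ring_simprules(2)[OF ring_Rbar] by simp
      then have "?y \<in> h ` carrier (R Quot ?J)"
        using bij by (simp add: bij_betw_def)
      then obtain r where "r \<in> carrier R" "h (?J +> r) = ?y"
        unfolding FactRing_def A_RCOSETS_def' by auto
      then show "y \<in> (\<lambda>r. h (?J +> r) i) ` carrier R"
        using i by (auto intro!: image_eqI[of _ _ r])
    qed
  next
    fix r assume r: "r \<in> carrier R" and zero: "\<And>i. i \<in> {1..s} \<Longrightarrow> h (?J +> r) i = \<zero>\<^bsub>Rbar i\<^esub>"
    \<comment> \<open>Tuples are fixed off the index set, so \<open>h (?J +> r)\<close> is zero as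
      soon as its entries in \<open>{1..s}\<close> are; injectivity of \<open>h\<close> then puts
      \<open>r\<close> in the radical.\<close>
    have "\<zero>\<^bsub>?P\<^esub> = h (?J +> r)"
      unfolding product_ring_simps(4)
      using zero by (intro restrict_eq_product_ring[OF ring_hom_closed[OF hom coset[OF r]]]) simp
    then have "h (?J +> r) = h \<zero>\<^bsub>R Quot ?J\<^esub>"
      using h0 by simp
    then have "?J +> r = \<zero>\<^bsub>R Quot ?J\<^esub>"
      using bij coset[OF r] ring.ring_simprules(2)[OF J.quotient_is_ring]
      unfolding bij_betw_def by (blast dest: inj_onD)
    then show "r \<in> ?J"
      using J.rcos_const_imp_mem[OF r] by (simp add: FactRing_def)
  next
    show "\<And>i. i \<in> {1..s} \<Longrightarrow> \<epsilon> i \<in> carrier R"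
      "\<And>i j. \<lbrakk>i \<in> {1..s}; j \<in> {1..s}\<rbrakk> \<Longrightarrow> \<epsilon> i \<otimes> \<epsilon> j = (if i = j then \<epsilon> i else \<zero>)"
      "(\<Oplus>i\<in>{1..s}. \<epsilon> i) = \<one>"
      using lift unfolding lifted_idempotents_def by blast+
    show "h (?J +> \<epsilon> i) j = (if j = i then \<one>\<^bsub>Rbar j\<^esub> else \<zero>\<^bsub>Rbar j\<^esub>)"
      if i: "i \<in> {1..s}" and j: "j \<in> {1..s}" for i j
    proof -
      have "h (?J +> \<epsilon> i) = (\<lambda>j\<in>{1..s}. if j = i then \<one>\<^bsub>Rbar j\<^esub> else \<zero>\<^bsub>Rbar j\<^esub>)"
        using lift i unfolding lifted_idempotents_def by blast
      with j show ?thesis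
        by simp
    qed
  qed
qed

theorem theorem5p6:
  fixes R :: "('a, 'm) ring_scheme" (structure)
    and s :: nat
    and Rbar :: "nat \<Rightarrow> ('b, 'n) ring_scheme"
    and h :: "'a set \<Rightarrow> nat \<Rightarrow> 'b"
    and \<epsilon> :: "nat \<Rightarrow> 'a"
    and e :: 'a
  assumes "left_artinian_ring R"
    and "semisimple_quotient_decomposition R s Rbar h"
    and "lifted_idempotents R s Rbar h \<epsilon>"
    and "e = (\<Oplus>e'\<in>min_I'_l R s \<epsilon>. e')"
  shows
    "(T_l R = \<Inter> (max_Den_l R) \<and>
      \<Inter> (max_Den_l R) =
        {u \<in> carrier R. \<forall>e'\<in>min_I'_l R s \<epsilon>.
           right_principal R (\<one> \<ominus> e') +> u \<in> Units (R Quot right_principal R (\<one> \<ominus> e'))}) \<and>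
     (ass_T_l R = ass_max R \<and> ass_max R = right_principal R (\<one> \<ominus> e)) \<and>
     (canonical_map R (T_l R) \<in> ring_iso (R Quot ass_T_l R) (Q_l_s R) \<and>
      (R Quot ass_T_l R) \<simeq> (R Quot right_principal R (\<one> \<ominus> e)) \<and>
      (R Quot right_principal R (\<one> \<ominus> e)) \<simeq>
        product_ring (min_I'_l R s \<epsilon>) (\<lambda>e'. R Quot right_principal R (\<one> \<ominus> e')) \<and>
      product_ring (min_I'_l R s \<epsilon>) (\<lambda>e'. R Quot right_principal R (\<one> \<ominus> e')) \<simeq>
        product_ring (max_Den_l R) (\<lambda>S. left_localization R S))"
proof -
  interpret lifted_decomposition R s Rbar "\<lambda>i r. h (jacobson_radical R +> r) i" \<epsilon>
    using assms(1-3) by (rule lifted_decompositionI)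
  have e: "e = min.total"
    unfolding min.total_def by (rule assms(4))
  have "\<Inter> (max_Den_l R) =
      {u \<in> carrier R. \<forall>e'\<in>min_I'_l R s \<epsilon>.
         right_principal R (\<one> \<ominus> e') +> u \<in> Units (R Quot right_principal R (\<one> \<ominus> e'))}"
    using min.M_nonempty unfolding max_Den_l_eq quotient_units_def by blast
  moreover have "R Quot ass_T_l R \<simeq> R Quot right_principal R (\<one> \<ominus> e)"
    unfolding e T_l_localization(1) by (rule ring_iso_refl)
  ultimately show ?thesis
    using T_l_eq T_l_localization ass_max_eq quotient_product_iso unfolding e by simp
qed

end
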